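(* Let $S$ be a trace class operator on $L^2(\mathbb{R}^d)$. The Arveson spectrum $\mathrm{sp}_\alpha(S)$ is the closure of the complement of $\{z\in\mathbb{R}^{2d}: \mathcal{F}_WS(-z)=0\}$.
   Context: For $z=(x,\omega)\in\mathbb{R}^{2d}$, $\pi(z)\psi(t)=e^{2\pi i\omega\cdot t}\psi(t-x)$ on $L^2(\mathbb{R}^d)$, and $\alpha_z(A)=\pi(z)A\pi(z)^*$ for $A\in B(L^2(\mathbb{R}^d))$. The Fourier-Wigner transform of a trace class operator $S$ is $\mathcal{F}_WS(z)=e^{-\pi i x\cdot\omega}\,\mathrm{tr}(\pi(-z)S)$. The symplectic Fourier transform of $f\in L^1(\mathbb{R}^{2d})$ is $\mathcal{F}_\sigma f(z)=\int_{\mathbb{R}^{2d}} f(z')e^{-2\pi i\sigma(z,z')}\,dz'$, where $\sigma(x_1,\omega_1;x_2,\omega_2)=\omega_1\cdot x_2-\omega_2\cdot x_1$. Arveson spectrum: for a von Neumann algebra $X$ with predual $X_*$, an automorphism group $\{U_z\}_{z\in\mathbb{R}^{2d}}$ on $X$ and $x\in X$, $\mathrm{sp}_U(x)$ is the spectrum of the family of functions $\{z\mapsto\rho(U_zx):\rho\in X_*\}$. Here $X=B(L^2(\mathbb{R}^d))$, $U=\alpha$, and $X_*$ is the space $\mathcal{T}^1$ of trace class operators, with $T\in\mathcal{T}^1$ acting by $A\mapsto\mathrm{tr}(T^*A)$. For $S\in\mathcal{T}^1$ the functions $z\mapsto\mathrm{tr}(T^*\alpha_zS)$, $T\in\mathcal{T}^1$,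 are in $L^1(\mathbb{R}^{2d})$. The spectrum of a function $f\in L^1(\mathbb{R}^{2d})$ is the closed support of $\mathcal{F}_\sigma f$, and the spectrum of a family of functions in $L^1(\mathbb{R}^{2d})$ is the closure of the complement of the set of common zeros of their symplectic Fourier transforms. *)

theory Defs
  imports "HOL-Analysis.Analysis"
begin

section \<open>The Hilbert space of square-integrable functions\<close>

definition square_integrable :: "(real^'d::finite \<Rightarrow> complex) \<Rightarrow> bool" where
  "square_integrable f \<longleftrightarrow>
     f \<in> borel_measurable lborel \<and> integrable lborel (\<lambda>t. (cmod (f t))\<^sup>2)"

lemma measurable_cnj [measurable]: "cnj \<in> borel_measurable borel"
  by (intro borel_measurable_continuous_onI continuous_intros)

lemma square_integrable_zero: "square_integrable (\<lambda>_. 0)"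
  by (simp add: square_integrable_def)

lemma square_integrable_scale:
  "square_integrable f \<Longrightarrow> square_integrable (\<lambda>t. c * f t)"
  by (auto simp: square_integrable_def norm_mult power_mult_distrib)

lemma square_integrable_add:
  assumes "square_integrable f" "square_integrable g"
  shows "square_integrable (\<lambda>t. f t + g t)"
proof -
  have [measurable]: "f \<in> borel_measurable lborel" "g \<in> borel_measurable lborel"
    using assms by (auto simp: square_integrable_def)
  have "integrable lborel (\<lambda>t. 2 * (cmod (f t))\<^sup>2 + 2 * (cmod (g t))\<^sup>2)"
    using assms by (auto simp: square_integrable_def)
  then have "integrable lborel (\<lambda>t. (cmod (f t + g t))\<^sup>2)"
  proof (rule Bochner_Integration.integrable_bound)
    show "AE t in lborel. norm ((cmod (f t + g t))\<^sup>2)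
        \<le> norm (2 * (cmod (f t))\<^sup>2 + 2 * (cmod (g t))\<^sup>2)"
    proof (rule AE_I2)
      fix t
      have "(cmod (f t + g t))\<^sup>2 \<le> (cmod (f t) + cmod (g t))\<^sup>2"
        by (intro power_mono norm_triangle_ineq) simp
      also have "\<dots> \<le> 2 * (cmod (f t))\<^sup>2 + 2 * (cmod (g t))\<^sup>2"
        using sum_squares_bound[of "cmod (f t)" "cmod (g t)"] by (simp add: power2_sum)
      finally show "norm ((cmod (f t + g t))\<^sup>2)
          \<le> norm (2 * (cmod (f t))\<^sup>2 + 2 * (cmod (g t))\<^sup>2)" by simp
    qed
  qed measurable
  then show ?thesis by (simp add: square_integrable_def)
qed

lemma square_integrable_mult_cnj:
  assumes "square_integrable f" "square_integrable g"
  shows "integrable lborel (\<lambda>t. f t * cnj (g t))"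
proof -
  have [measurable]: "f \<in> borel_measurable lborel" "g \<in> borel_measurable lborel"
    using assms by (auto simp: square_integrable_def)
  have "integrable lborel (\<lambda>t. (cmod (f t))\<^sup>2 + (cmod (g t))\<^sup>2)"
    using assms by (auto simp: square_integrable_def)
  then show ?thesis
  proof (rule Bochner_Integration.integrable_bound)
    show "AE t in lborel. norm (f t * cnj (g t)) \<le> norm ((cmod (f t))\<^sup>2 + (cmod (g t))\<^sup>2)"
    proof (rule AE_I2)
      fix t
      have "0 \<le> cmod (f t) * cmod (g t)" by simp
      with sum_squares_bound[of "cmod (f t)" "cmod (g t)"]
      have "cmod (f t) * cmod (g t) \<le> (cmod (f t))\<^sup>2 + (cmod (g t))\<^sup>2"
        by linarith
      then show "norm (f t * cnj (g t)) \<le> norm ((cmod (f t))\<^sup>2 + (cmod (g t))\<^sup>2)"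
        by (simp add: norm_mult)
    qed
  qed measurable
qed

definition ae_eq :: "(real^'d::finite \<Rightarrow> complex) \<Rightarrow> (real^'d \<Rightarrow> complex) \<Rightarrow> bool" where
  "ae_eq f g \<longleftrightarrow>
     square_integrable f \<and> square_integrable g \<and> (AE t in lborel. f t = g t)"

quotient_type (overloaded) 'd L2 = "real^'d::finite \<Rightarrow> complex" / partial: ae_eq
proof (rule part_equivpI)
  show "\<exists>f :: real^'d \<Rightarrow> complex. ae_eq f f"
    using square_integrable_zero by (auto simp: ae_eq_def)
  show "symp (ae_eq :: (real^'d \<Rightarrow> complex) \<Rightarrow> _)"
    by (auto simp: ae_eq_def symp_def elim!: AE_mp)
  show "transp (ae_eq :: (real^'d \<Rightarrow> complex) \<Rightarrow> _)"
  proof (rule transpI)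
    fix f g h :: "real^'d \<Rightarrow> complex"
    assume a: "ae_eq f g" "ae_eq g h"
    then have "AE t in lborel. f t = g t" "AE t in lborel. g t = h t"
      by (auto simp: ae_eq_def)
    then have "AE t in lborel. f t = h t" by eventually_elim simp
    with a show "ae_eq f h" by (simp add: ae_eq_def)
  qed
qed

lift_definition cscale :: "complex \<Rightarrow> 'd::finite L2 \<Rightarrow> 'd L2" is "\<lambda>c f t. c * f t"
  by (auto simp: ae_eq_def square_integrable_scale elim!: AE_mp)

text \<open>The inner product is linear in the first argument.\<close>

lift_definition cinner :: "'d::finite L2 \<Rightarrow> 'd L2 \<Rightarrow> complex" is
  "\<lambda>f g. \<integral>t. f t * cnj (g t) \<partial>lborel"
proof -
  fix f f' g g' :: "real^'d \<Rightarrow> complex"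
  assume a: "ae_eq f f'" "ae_eq g g'"
  then have ae: "AE t in lborel. f t = f' t" "AE t in lborel. g t = g' t"
    by (auto simp: ae_eq_def)
  have "f \<in> borel_measurable lborel" "f' \<in> borel_measurable lborel"
    "g \<in> borel_measurable lborel" "g' \<in> borel_measurable lborel"
    using a by (auto simp: ae_eq_def square_integrable_def)
  note [measurable] = this
  show "(\<integral>t. f t * cnj (g t) \<partial>lborel) = (\<integral>t. f' t * cnj (g' t) \<partial>lborel)"
  proof (rule integral_cong_AE)
    show "AE t in lborel. f t * cnj (g t) = f' t * cnj (g' t)"
      using ae by eventually_elim simp
  qed measurable
qed

instantiation L2 :: (finite) real_vector
begin

lift_definition zero_L2 :: "'a L2" is "\<lambda>_. 0"
  by (simp add: ae_eq_def square_integrable_zero)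

lift_definition plus_L2 :: "'a L2 \<Rightarrow> 'a L2 \<Rightarrow> 'a L2" is "\<lambda>f g t. f t + g t"
proof -
  fix f f' g g' :: "real^'a \<Rightarrow> complex"
  assume a: "ae_eq f f'" "ae_eq g g'"
  then have "AE t in lborel. f t = f' t" "AE t in lborel. g t = g' t"
    by (auto simp: ae_eq_def)
  then have "AE t in lborel. f t + g t = f' t + g' t" by eventually_elim simp
  with a show "ae_eq (\<lambda>t. f t + g t) (\<lambda>t. f' t + g' t)"
    by (simp add: ae_eq_def square_integrable_add)
qed

definition scaleR_L2 :: "real \<Rightarrow> 'a L2 \<Rightarrow> 'a L2" where
  "scaleR_L2 r f = cscale (complex_of_real r) f"

definition uminus_L2 :: "'a L2 \<Rightarrow> 'a L2" where "uminus_L2 f = cscale (-1) f"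
definition minus_L2 :: "'a L2 \<Rightarrow> 'a L2 \<Rightarrow> 'a L2" where "minus_L2 f g = f + (- g)"

instance
proof
  fix f g h :: "'a L2" and a b :: real
  show "f + g + h = f + (g + h)"
    by transfer (auto simp: ae_eq_def square_integrable_add add.assoc)
  show "f + g = g + f"
    by transfer (auto simp: ae_eq_def square_integrable_add add.commute)
  show "0 + f = f"
    by transfer (auto simp: ae_eq_def)
  show "- f + f = 0"
    unfolding uminus_L2_def
    by transfer (auto simp: ae_eq_def square_integrable_zero)
  show "f - g = f + - g" by (simp add: minus_L2_def)
  show "a *\<^sub>R (f + g) = a *\<^sub>R f + a *\<^sub>R g"
    unfolding scaleR_L2_def
    by transfer (auto simp: ae_eq_def distrib_left square_integrable_add
        intro: square_integrable_add square_integrable_scale)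
  show "(a + b) *\<^sub>R f = a *\<^sub>R f + b *\<^sub>R f"
    unfolding scaleR_L2_def
    by transfer (auto simp: ae_eq_def distrib_right
        intro: square_integrable_add square_integrable_scale)
  show "a *\<^sub>R b *\<^sub>R f = (a * b) *\<^sub>R f"
    unfolding scaleR_L2_def
    by transfer (auto simp: ae_eq_def mult.assoc intro!: square_integrable_scale)
  show "1 *\<^sub>R f = f"
    unfolding scaleR_L2_def
    by transfer (auto simp: ae_eq_def)
qed

end

instantiation L2 :: (finite) real_inner
begin

definition inner_L2 :: "'a L2 \<Rightarrow> 'a L2 \<Rightarrow> real" where "inner_L2 f g = Re (cinner f g)"
definition norm_L2 :: "'a L2 \<Rightarrow> real" where "norm_L2 f = sqrt (inner f f)"
definition sgn_L2 :: "'a L2 \<Rightarrow> 'a L2" where "sgn_L2 f = f /\<^sub>R norm f"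
definition dist_L2 :: "'a L2 \<Rightarrow> 'a L2 \<Rightarrow> real" where "dist_L2 f g = norm (f - g)"
definition uniformity_L2 :: "('a L2 \<times> 'a L2) filter" where
  "uniformity_L2 = (INF e\<in>{0<..}. principal {(f, g). dist f g < e})"
definition open_L2 :: "'a L2 set \<Rightarrow> bool" where
  "open_L2 U \<longleftrightarrow> (\<forall>f\<in>U. \<forall>\<^sub>F (f', g) in uniformity. f' = f \<longrightarrow> g \<in> U)"

instance
proof
  fix f g h :: "'a L2" and r :: real
  show "sgn f = f /\<^sub>R norm f" by (simp add: sgn_L2_def)
  show "dist f g = norm (f - g)" by (simp add: dist_L2_def)
  show "(uniformity :: ('a L2 \<times> 'a L2) filter) = (INF e\<in>{0<..}. principal {(f, g). dist f g < e})"
    by (simp add: uniformity_L2_def)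
  show "norm f = sqrt (inner f f)" by (simp add: norm_L2_def)
  have "cinner f g = cnj (cinner g f)"
    by transfer (simp flip: Bochner_Integration.integral_cnj add: mult.commute)
  then show "inner f g = inner g f" by (simp add: inner_L2_def)
  have "cinner (f + g) h = cinner f h + cinner g h"
    by transfer (auto simp: ae_eq_def distrib_right
        intro!: Bochner_Integration.integral_add square_integrable_mult_cnj)
  then show "inner (f + g) h = inner f h + inner g h" by (simp add: inner_L2_def)
  have "cinner (cscale (complex_of_real r) f) g = complex_of_real r * cinner f g"
    by transfer (simp add: mult.assoc)
  then show "inner (r *\<^sub>R f) g = r * inner f g" by (simp add: inner_L2_def scaleR_L2_def)
  have nonneg: "\<exists>I\<ge>0. cinner f f = complex_of_real I \<and> (I = 0 \<longrightarrow> f = 0)"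
  proof transfer
    fix f :: "real^'a \<Rightarrow> complex"
    assume "ae_eq f f"
    then have f: "square_integrable f" by (simp add: ae_eq_def)
    then have int: "integrable lborel (\<lambda>t. (cmod (f t))\<^sup>2)"
      by (simp add: square_integrable_def)
    let ?I = "\<integral>t. (cmod (f t))\<^sup>2 \<partial>lborel"
    have "(\<integral>t. f t * cnj (f t) \<partial>lborel) = complex_of_real ?I"
      by (simp only: complex_norm_square[symmetric] integral_complex_of_real)
    moreover have "ae_eq f (\<lambda>_. 0)" if "?I = 0"
    proof -
      from that have "AE t in lborel. (cmod (f t))\<^sup>2 = 0"
        using integral_nonneg_eq_0_iff_AE[OF int] by simp
      then have "AE t in lborel. f t = 0" by eventually_elim simp
      with f show ?thesis by (simp add: ae_eq_def square_integrable_zero)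
    qed
    moreover have "0 \<le> ?I" by simp
    ultimately show "\<exists>I\<ge>0. (\<integral>t. f t * cnj (f t) \<partial>lborel) = complex_of_real I
        \<and> (I = 0 \<longrightarrow> ae_eq f (\<lambda>_. 0))" by blast
  qed
  then show "0 \<le> inner f f" by (auto simp: inner_L2_def)
  have "cinner 0 (0 :: 'a L2) = 0" by transfer simp
  with nonneg show "inner f f = 0 \<longleftrightarrow> f = 0" by (auto simp: inner_L2_def)
qed (simp add: open_L2_def)

end

global_interpretation L2: vector_space "cscale :: complex \<Rightarrow> 'd::finite L2 \<Rightarrow> 'd L2"
  defines cspan = L2.span
proof
  fix a b :: complex and f g :: "'d L2"
  show "cscale a (f + g) = cscale a f + cscale a g"
    by transfer (auto simp: ae_eq_def distrib_left
        intro: square_integrable_add square_integrable_scale)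
  show "cscale (a + b) f = cscale a f + cscale b f"
    by transfer (auto simp: ae_eq_def distrib_right
        intro: square_integrable_add square_integrable_scale)
  show "cscale a (cscale b f) = cscale (a * b) f"
    by transfer (auto simp: ae_eq_def mult.assoc intro!: square_integrable_scale)
  show "cscale 1 f = f"
    by transfer (auto simp: ae_eq_def)
qed

section \<open>Bounded and trace class operators\<close>

text \<open>The library's \<^const>\<open>bounded_linear\<close> is real-linear; complex homogeneity is added.\<close>

definition bounded_operator :: "('d::finite L2 \<Rightarrow> 'd L2) \<Rightarrow> bool" where
  "bounded_operator A \<longleftrightarrow> bounded_linear A \<and> (\<forall>c f. A (cscale c f) = cscale c (A f))"

definition adj :: "('d::finite L2 \<Rightarrow> 'd L2) \<Rightarrow> 'd L2 \<Rightarrow> 'd L2" where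
  "adj A = (THE B. bounded_operator B \<and> (\<forall>f g. cinner (A f) g = cinner f (B g)))"

definition positive_operator :: "('d::finite L2 \<Rightarrow> 'd L2) \<Rightarrow> bool" where
  "positive_operator P \<longleftrightarrow>
     bounded_operator P \<and> (\<forall>f. cinner (P f) f \<in> \<real> \<and> 0 \<le> Re (cinner (P f) f))"

definition orthonormal_basis :: "'d::finite L2 set \<Rightarrow> bool" where
  "orthonormal_basis E \<longleftrightarrow>
     (\<forall>e\<in>E. \<forall>e'\<in>E. cinner e e' = (if e = e' then 1 else 0)) \<and> closure (cspan E) = UNIV"

text \<open>
  The operator \<open>P\<close> below is the absolute value \<open>\<bar>S\<bar> = (S\<^sup>* S)\<^sup>1\<^sup>/\<^sup>2\<close>, the unique positive square root,
  and the condition is \<open>tr \<bar>S\<bar> < \<infinity>\<close>.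
  Neither summability of the diagonal of a positive operator nor the trace of a trace class
  operator depends on the orthonormal basis.
\<close>

definition trace_class :: "('d::finite L2 \<Rightarrow> 'd L2) \<Rightarrow> bool" where
  "trace_class S \<longleftrightarrow> bounded_operator S \<and>
     (\<exists>P. positive_operator P \<and> P \<circ> P = adj S \<circ> S \<and>
       (\<exists>E. orthonormal_basis E \<and> (\<lambda>e. cinner (P e) e) summable_on E))"

definition operator_trace :: "('d::finite L2 \<Rightarrow> 'd L2) \<Rightarrow> complex" where
  "operator_trace A = (\<Sum>\<^sub>\<infinity>e\<in>(SOME E. orthonormal_basis E). cinner (A e) e)"

section \<open>Time-frequency shifts and Fourier transforms\<close>

type_synonym 'd phase_space = "(real^'d) \<times> (real^'d)"

lift_definition time_freq_shift :: "'d::finite phase_space \<Rightarrow> 'd L2 \<Rightarrow> 'd L2" is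
  "\<lambda>(x, \<omega>) \<psi> t. exp (2 * pi * \<i> * complex_of_real (\<omega> \<bullet> t)) * \<psi> (t - x)"
proof -
  fix z :: "'d phase_space" and f g :: "real^'d \<Rightarrow> complex"
  assume "ae_eq f g"
  then have f: "square_integrable f" and g: "square_integrable g"
    and ae: "AE t in lborel. f t = g t" by (auto simp: ae_eq_def)
  obtain x \<omega> where z: "z = (x, \<omega>)" by fastforce
  have lb: "lborel = distr lborel borel (\<lambda>t. t - x)"
  proof -
    have "(+) (- x) = (\<lambda>t. t - x)" by auto
    with lborel_distr_plus[of "- x"] show ?thesis by simp
  qed
  have shift: "square_integrable
      (\<lambda>t. exp (2 * pi * \<i> * complex_of_real (\<omega> \<bullet> t)) * h (t - x))"
    if h: "square_integrable h" for h :: "real^'d \<Rightarrow> complex"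
  proof -
    have [measurable]: "h \<in> borel_measurable borel"
      using h by (simp add: square_integrable_def)
    have "integrable (distr lborel borel (\<lambda>t. t - x)) (\<lambda>t. (cmod (h t))\<^sup>2)"
      using h by (simp add: square_integrable_def lb[symmetric])
    then have "integrable lborel (\<lambda>t. (cmod (h (t - x)))\<^sup>2)"
      by (subst (asm) integrable_distr_eq) auto
    moreover have "(\<lambda>t. exp (2 * pi * \<i> * complex_of_real (\<omega> \<bullet> t)) * h (t - x))
        \<in> borel_measurable lborel" by measurable
    ultimately show ?thesis
      by (simp add: square_integrable_def norm_mult)
  qed
  have [measurable]: "f \<in> borel_measurable borel" "g \<in> borel_measurable borel"
    using f g by (auto simp: square_integrable_def)
  from ae have "AE t in distr lborel borel (\<lambda>t. t - x). f t = g t"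
    by (subst lb[symmetric])
  then have "AE t in lborel. f (t - x) = g (t - x)"
    by (subst (asm) AE_distr_iff) auto
  then have "AE t in lborel. exp (2 * pi * \<i> * complex_of_real (\<omega> \<bullet> t)) * f (t - x)
      = exp (2 * pi * \<i> * complex_of_real (\<omega> \<bullet> t)) * g (t - x)"
    by eventually_elim simp
  with shift[OF f] shift[OF g]
  show "ae_eq ((case z of (x, \<omega>) \<Rightarrow> \<lambda>\<psi> t. exp (2 * pi * \<i> * complex_of_real (\<omega> \<bullet> t)) * \<psi> (t - x)) f)
      ((case z of (x, \<omega>) \<Rightarrow> \<lambda>\<psi> t. exp (2 * pi * \<i> * complex_of_real (\<omega> \<bullet> t)) * \<psi> (t - x)) g)"
    by (simp add: z ae_eq_def)
qed

definition operator_shift ::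
    "'d::finite phase_space \<Rightarrow> ('d L2 \<Rightarrow> 'd L2) \<Rightarrow> 'd L2 \<Rightarrow> 'd L2" where
  "operator_shift z A = time_freq_shift z \<circ> A \<circ> adj (time_freq_shift z)"

definition fourier_wigner :: "('d::finite L2 \<Rightarrow> 'd L2) \<Rightarrow> 'd phase_space \<Rightarrow> complex" where
  "fourier_wigner S = (\<lambda>(x, \<omega>).
     exp (- pi * \<i> * complex_of_real (x \<bullet> \<omega>)) * operator_trace (time_freq_shift (- (x, \<omega>)) \<circ> S))"

definition symplectic_form :: "'d::finite phase_space \<Rightarrow> 'd phase_space \<Rightarrow> real" where
  "symplectic_form = (\<lambda>(x\<^sub>1, \<omega>\<^sub>1) (x\<^sub>2, \<omega>\<^sub>2). \<omega>\<^sub>1 \<bullet> x\<^sub>2 - \<omega>\<^sub>2 \<bullet> x\<^sub>1)"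

definition symplectic_fourier ::
    "('d::finite phase_space \<Rightarrow> complex) \<Rightarrow> 'd phase_space \<Rightarrow> complex" where
  "symplectic_fourier f z =
     (\<integral>z'. f z' * exp (- 2 * pi * \<i> * complex_of_real (symplectic_form z z')) \<partial>lborel)"

section \<open>Arveson spectrum\<close>

text \<open>
  Intended for families of integrable functions; the Bochner integral of a non-integrable
  function is \<open>0\<close>, so such a function would impose no condition here.
\<close>

definition spectrum_of_family :: "('d::finite phase_space \<Rightarrow> complex) set \<Rightarrow> 'd phase_space set" where
  "spectrum_of_family F = closure (- {z. \<forall>f\<in>F. symplectic_fourier f z = 0})"

text \<open>
  The arguments are the predual, given as a set of functionals, the automorphism group,
  and the element.
\<close>

definition arveson_spectrum ::
    "('x \<Rightarrow> complex) set \<Rightarrow> ('d::finite phase_space \<Rightarrow> 'x \<Rightarrow> 'x) \<Rightarrow> 'x \<Rightarrow> 'd phase_space set" where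
  "arveson_spectrum predual U x = spectrum_of_family ((\<lambda>\<rho> z. \<rho> (U z x)) ` predual)"

definition operator_predual :: "(('d::finite L2 \<Rightarrow> 'd L2) \<Rightarrow> complex) set" where
  "operator_predual = (\<lambda>T A. operator_trace (adj T \<circ> A)) ` {T. trace_class T}"

end

theory Submission
  imports Defs "HOL-Probability.Characteristic_Functions"
begin

text \<open>
  The symplectic Fourier transform of \<open>z' \<mapsto> tr(T\<^sup>* \<alpha>\<^bsub>z'\<^esub> S)\<close> at \<open>z\<close> is \<open>tr(\<pi>(z) S)\<close> times the complex
  conjugate of \<open>tr(\<pi>(z) T)\<close>. For rank one \<open>S\<close> and \<open>T\<close> this is Moyal's identity, since \<open>\<pi>(z)\<close> and
  \<open>\<pi>(z')\<close> commute up to the character in the symplectic Fourier transform; trace class operators are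
  absolutely convergent series of rank one operators. Up to a phase, \<open>tr(\<pi>(z) S)\<close> is the
  Fourier-Wigner transform of \<open>S\<close> at \<open>-z\<close>, and \<open>tr(\<pi>(z) T) = \<parallel>p\<parallel>\<^sup>2\<close> for the rank one operator
  \<open>T f = \<langle>f, \<pi>(z) p\<rangle> p\<close>. So the two sets of zeros agree even before taking closures.
\<close>

section \<open>The Hilbert space and its operators\<close>

subsection \<open>The inner product\<close>

text \<open>The definitions give a bare inner product space, with \<open>adj\<close> as a definite
  description and \<open>operator_trace\<close> over an unspecified basis, so both must first be
  shown to mean something. Completeness of \<open>L2\<close> enters for this reason alone: through
  Riesz representation it makes \<open>adj\<close> denote a genuine adjoint. An orthonormal basis is
  at hand because \<open>trace_class\<close> asserts one, and the trace of an absolutely convergent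
  rank one series has the same value in whichever basis is chosen. The analytic obstacle is the
  exchange of the phase space integral with a double series of rank one terms. The two vectors of
  each term are given equal norms, so the arithmetic-geometric mean bound for a product of matrix
  coefficients is already a product of one summable factor per index. Moyal's identity rests on
  Plancherel for integrable and square-integrable functions, proved by Gaussian regularisation;
  removing the Gaussian is what requires continuity of translations, and hence density of continuous
  functions.\<close>

lemma ae_eq_refl: "ae_eq f f \<longleftrightarrow> square_integrable f"
  by (auto simp: ae_eq_def)

lemma cinner_commute: "cinner f g = cnj (cinner g f)"
  by transfer (simp flip: Bochner_Integration.integral_cnj add: mult.commute)

lemma cmod_cinner_commute: "cmod (cinner f g) = cmod (cinner g f)"
  by (subst cinner_commute) (rule complex_mod_cnj)

lemma cinner_add_left: "cinner (f + g) h = cinner f h + cinner g h"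
  by transfer (auto simp: ae_eq_def distrib_right
      intro!: Bochner_Integration.integral_add square_integrable_mult_cnj)

lemma cinner_cscale_left: "cinner (cscale c f) g = c * cinner f g"
  by transfer (simp add: mult.assoc)

lemma cinner_add_right: "cinner h (f + g) = cinner h f + cinner h g"
  unfolding cinner_commute[of h] by (simp add: cinner_add_left)

lemma cinner_cscale_right: "cinner f (cscale c g) = cnj c * cinner f g"
  unfolding cinner_commute[of f] by (simp add: cinner_cscale_left)

lemma scaleR_L2_eq: "r *\<^sub>R f = cscale (complex_of_real r) f" for f :: "'d::finite L2"
  by (simp add: scaleR_L2_def)

lemma cinner_self: "cinner f f = of_real ((norm f)\<^sup>2)"
proof -
  have "cinner f f \<in> \<real>"
    unfolding Reals_cnj_iff by (rule cinner_commute[symmetric])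
  then have "cinner f f = of_real (Re (cinner f f))"
    by simp
  also have "Re (cinner f f) = (norm f)\<^sup>2"
    by (simp add: power2_norm_eq_inner inner_L2_def)
  finally show ?thesis .
qed

lemma norm_cscale: "norm (cscale c f) = cmod c * norm f"
proof -
  have "complex_of_real ((norm (cscale c f))\<^sup>2) = of_real ((cmod c * norm f)\<^sup>2)"
    unfolding cinner_self[symmetric] cinner_cscale_left cinner_cscale_right
    by (simp add: cinner_self power_mult_distrib complex_norm_square del: of_real_power)
  then have "(norm (cscale c f))\<^sup>2 = (cmod c * norm f)\<^sup>2"
    unfolding of_real_eq_iff .
  then show ?thesis by (simp add: power2_eq_iff_nonneg)
qed

text \<open>A unimodular multiple of \<open>f\<close> makes the inner product real and nonnegative,
  so the real Cauchy-Schwarz inequality of \<open>real_inner\<close> applies.\<close>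

lemma cmod_cinner_le: "cmod (cinner f g) \<le> norm f * norm g"
proof (cases "cinner f g = 0")
  case False
  define c where "c = cnj (sgn (cinner f g))"
  have "cmod c = 1" using False by (simp add: c_def norm_sgn)
  have "complex_of_real (cmod (cinner f g)) = cinner (cscale c f) g"
    by (simp add: cinner_cscale_left c_def sgn_eq complex_norm_square[symmetric] 
        mult.commute[of "cnj _"] power2_eq_square False)
  then have "cmod (cinner f g) = inner (cscale c f) g"
    by (metis Re_complex_of_real inner_L2_def)
  also have "\<dots> \<le> norm (cscale c f) * norm g" by (rule norm_cauchy_schwarz)
  finally show ?thesis by (simp add: norm_cscale \<open>cmod c = 1\<close>)
qed auto

lemma bounded_bilinear_cinner: "bounded_bilinear (cinner :: 'd::finite L2 \<Rightarrow> _)"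
proof
  show "\<exists>K. \<forall>a b :: 'd L2. cmod (cinner a b) \<le> norm a * norm b * K"
    using cmod_cinner_le by (metis mult.right_neutral)
qed (simp_all add: cinner_add_left cinner_add_right scaleR_L2_eq cinner_cscale_left
      cinner_cscale_right scaleR_conv_of_real)

interpretation cinner: bounded_bilinear cinner
  by (rule bounded_bilinear_cinner)

lemma bounded_bilinear_cscale: "bounded_bilinear (cscale :: complex \<Rightarrow> 'd::finite L2 \<Rightarrow> _)"
proof
  show "\<exists>K. \<forall>a (b :: 'd L2). norm (cscale a b) \<le> norm a * norm b * K"
    by (metis mult.right_neutral norm_cscale order_refl)
qed (simp_all add: L2.scale_left_distrib L2.scale_right_distrib scaleR_L2_eq scaleR_conv_of_real
    mult.commute)

interpretation cscale: bounded_bilinear cscale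
  by (rule bounded_bilinear_cscale)

lemma cinner_eqI: "f = g" if "\<And>h. cinner f h = cinner g h"
proof -
  have "cinner (f - g) (f - g) = 0"
    unfolding cinner.diff_left by (simp add: that)
  then show ?thesis by (simp add: cinner_self)
qed

lemma cinner_eqI': "f = g" if "\<And>h. cinner h f = cinner h g"
proof (rule cinner_eqI)
  fix h show "cinner f h = cinner g h"
    unfolding cinner_commute[of _ h] that ..
qed

lemma bounded_operatorI:
  assumes "\<And>f g. A (f + g) = A f + A g" "\<And>c f. A (cscale c f) = cscale c (A f)"
    "\<And>f. norm (A f) \<le> norm f * K"
  shows "bounded_operator A"
  unfolding bounded_operator_def
  using assms by (auto simp: scaleR_L2_eq intro!: bounded_linear_intro[where K=K])

text \<open>Inner products separate vectors, so the adjoint relation has at most one solution; this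
  evaluates the \<open>THE\<close> in \<open>adj\<close>.\<close>

lemma adj_eqI:
  assumes "bounded_operator B" "\<And>f g. cinner (A f) g = cinner f (B g)"
  shows "adj A = B"
  unfolding adj_def
proof (rule the_equality)
  show "bounded_operator B \<and> (\<forall>f g. cinner (A f) g = cinner f (B g))"
    using assms by auto
  fix C assume C: "bounded_operator C \<and> (\<forall>f g. cinner (A f) g = cinner f (C g))"
  show "C = B"
  proof
    fix g show "C g = B g"
      using C assms(2) by (intro cinner_eqI') metis
  qed
qed

subsection \<open>Orthonormal expansions\<close>

lemma cspan_finite_sum:
  assumes "h \<in> cspan E"
  shows "\<exists>F c. finite F \<and> F \<subseteq> E \<and> h = (\<Sum>e\<in>F. cscale (c e) e)"
  using assms unfolding L2.span_explicit by blast

text \<open>The residual of the projection is orthogonal to every element of \<open>F\<close>, so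
  Pythagoras splits \<open>f - ?h\<close> into that residual and \<open>?p - ?h\<close>.\<close>

lemma best_approx:
  fixes f :: "'d::finite L2"
  assumes "finite F" and ortho: "\<And>e e'. e \<in> F \<Longrightarrow> e' \<in> F \<Longrightarrow> cinner e e' = (if e = e' then 1 else 0)"
  shows "norm (f - (\<Sum>e\<in>F. cscale (cinner f e) e)) \<le> norm (f - (\<Sum>e\<in>F. cscale (c e) e))"
proof -
  let ?p = "\<Sum>e\<in>F. cscale (cinner f e) e"
  let ?h = "\<Sum>e\<in>F. cscale (c e) e"
  have coef: "cinner (\<Sum>e\<in>F. cscale (d e) e) e' = d e'" if "e' \<in> F" for d e'
  proof -
    have "cinner (\<Sum>e\<in>F. cscale (d e) e) e' = (\<Sum>e\<in>F. d e * cinner e e')"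
      by (simp add: cinner.sum_left cinner_cscale_left)
    also have "\<dots> = (\<Sum>e\<in>F. if e' = e then d e else 0)"
      using that by (intro sum.cong) (auto simp: ortho)
    also have "\<dots> = d e'"
      using that assms(1) by simp
    finally show ?thesis .
  qed
  have perp: "cinner (f - ?p) e = 0" if "e \<in> F" for e
    by (simp add: cinner.diff_left coef that)
  have "cinner (f - ?p) (?p - ?h) = 0"
    by (simp add: cinner.diff_right cinner.sum_right cinner_cscale_right perp)
  then have "inner (f - ?p) (?p - ?h) = 0"
    by (simp add: inner_L2_def)
  then have "(norm ((f - ?p) + (?p - ?h)))\<^sup>2 = (norm (f - ?p))\<^sup>2 + (norm (?p - ?h))\<^sup>2"
    by (simp add: power2_norm_eq_inner algebra_simps inner_commute)
  then have "(norm (f - ?p))\<^sup>2 \<le> (norm (f - ?h))\<^sup>2" by simp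
  then show ?thesis by (rule power2_le_imp_le) simp
qed

text \<open>Density of the span gives one approximant supported on a finite \<open>F\<close>. By
  best approximation every finite \<open>G\<close> containing \<open>F\<close> does at least as
  well, which is convergence along finite subsets.\<close>

lemma has_sum_orthonormal_basis:
  fixes f :: "'d::finite L2"
  assumes "orthonormal_basis E"
  shows "((\<lambda>e. cscale (cinner f e) e) has_sum f) E"
  unfolding has_sum_def tendsto_iff
proof (intro allI impI)
  fix \<epsilon> :: real assume "0 < \<epsilon>"
  have "f \<in> closure (cspan E)" using assms by (simp add: orthonormal_basis_def)
  then obtain h where h: "h \<in> cspan E" "dist h f < \<epsilon>"
    using \<open>0 < \<epsilon>\<close> closure_approachable by blast
  obtain F c where F: "finite F" "F \<subseteq> E" "h = (\<Sum>e\<in>F. cscale (c e) e)"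
    using cspan_finite_sum[OF h(1)] by blast
  show "\<forall>\<^sub>F G in finite_subsets_at_top E. dist (\<Sum>e\<in>G. cscale (cinner f e) e) f < \<epsilon>"
    unfolding eventually_finite_subsets_at_top
  proof (intro exI conjI allI impI)
    fix G assume G: "finite G \<and> F \<subseteq> G \<and> G \<subseteq> E"
    \<comment> \<open>Zero coefficients turn \<open>h\<close> into a competitor over
      \<open>G\<close>.\<close>
    have "h = (\<Sum>e\<in>G. cscale (if e \<in> F then c e else 0) e)"
      unfolding F(3) using G by (intro sum.mono_neutral_cong_left) auto
    moreover have "norm (f - (\<Sum>e\<in>G. cscale (cinner f e) e))
        \<le> norm (f - (\<Sum>e\<in>G. cscale (if e \<in> F then c e else 0) e))"
      by (rule best_approx) (use assms G in \<open>auto simp: orthonormal_basis_def subset_iff\<close>)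
    ultimately show "dist (\<Sum>e\<in>G. cscale (cinner f e) e) f < \<epsilon>"
      using h(2) by (simp add: dist_norm norm_minus_commute)
  qed (use F in auto)
qed

lemma has_sum_parseval:
  assumes "orthonormal_basis E"
  shows "((\<lambda>e. cinner f e * cinner e g) has_sum cinner f g) E"
  using has_sum_bounded_linear[OF cinner.bounded_linear_left has_sum_orthonormal_basis[OF assms, of f], of g]
  by (simp add: cinner_cscale_left)

lemma has_sum_parseval_norm:
  assumes "orthonormal_basis E"
  shows "((\<lambda>e. (cmod (cinner f e))\<^sup>2) has_sum (norm f)\<^sup>2) E"
proof -
  have "((\<lambda>e. cinner f e * cinner e f) has_sum cinner f f) E"
    by (rule has_sum_parseval[OF assms])
  also have "(\<lambda>e. cinner f e * cinner e f) = (\<lambda>e. of_real ((cmod (cinner f e))\<^sup>2))"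
  proof
    fix e
    have "cinner e f = cnj (cinner f e)" by (rule cinner_commute)
    then show "cinner f e * cinner e f = of_real ((cmod (cinner f e))\<^sup>2)"
      by (simp only: complex_norm_square)
  qed
  finally show ?thesis
    unfolding cinner_self by (simp only: has_sum_of_real_iff)
qed

text \<open>Cauchy-Schwarz on finite subsets together with Bessel's inequality. The absolute bound
  is what later permits exchanging a basis sum with a nuclear series.\<close>

lemma parseval_abs:
  assumes "orthonormal_basis E"
  shows "(\<lambda>e. cmod (cinner f e * cinner e g)) summable_on E"
    and "infsum (\<lambda>e. cmod (cinner f e * cinner e g)) E \<le> norm f * norm g"
proof -
  have fin: "sum (\<lambda>e. cmod (cinner f e * cinner e g)) F \<le> norm f * norm g"
    if F: "finite F" "F \<subseteq> E" for F
  proof -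
    have le: "(\<Sum>e\<in>F. (cmod (cinner h e))\<^sup>2) \<le> (norm h)\<^sup>2" for h
    proof (rule has_sum_mono_neutral)
      show "((\<lambda>e. (cmod (cinner h e))\<^sup>2) has_sum (\<Sum>e\<in>F. (cmod (cinner h e))\<^sup>2)) F"
        by (rule has_sum_finite[OF F(1)])
      show "((\<lambda>e. (cmod (cinner h e))\<^sup>2) has_sum (norm h)\<^sup>2) E"
        by (rule has_sum_parseval_norm[OF assms])
    qed (use F(2) in auto)
    have "(\<Sum>e\<in>F. cmod (cinner f e) * cmod (cinner g e))\<^sup>2
        \<le> (\<Sum>e\<in>F. (cmod (cinner f e))\<^sup>2) * (\<Sum>e\<in>F. (cmod (cinner g e))\<^sup>2)"
      by (rule Cauchy_Schwarz_ineq_sum)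
    also have "\<dots> \<le> (norm f)\<^sup>2 * (norm g)\<^sup>2"
      by (intro mult_mono le sum_nonneg) auto
    finally have "(\<Sum>e\<in>F. cmod (cinner f e) * cmod (cinner g e)) \<le> norm f * norm g"
      unfolding power_mult_distrib[symmetric] by (rule power2_le_imp_le) simp
    moreover have "cmod (cinner e g) = cmod (cinner g e)" for e
      by (rule cmod_cinner_commute)
    ultimately show ?thesis
      by (simp add: norm_mult)
  qed
  show s: "(\<lambda>e. cmod (cinner f e * cinner e g)) summable_on E"
  proof (rule nonneg_bdd_above_summable_on)
    show "bdd_above (sum (\<lambda>e. cmod (cinner f e * cinner e g)) ` {F. F \<subseteq> E \<and> finite F})"
      using fin by (intro bdd_aboveI[where M="norm f * norm g"]) blast
  qed simp
  show "infsum (\<lambda>e. cmod (cinner f e * cinner e g)) E \<le> norm f * norm g"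
    by (rule infsum_le_finite_sums[OF s]) (rule fin)
qed

section \<open>Bounded operators and computation with representatives\<close>

lemma bounded_operatorD:
  assumes "bounded_operator A"
  shows "bounded_linear A" "A (cscale c f) = cscale c (A f)" "A (f + g) = A f + A g"
    "A 0 = 0" "A (f - g) = A f - A g" "A (sum h F) = (\<Sum>x\<in>F. A (h x))"
proof -
  show l: "bounded_linear A" "A (cscale c f) = cscale c (A f)"
    using assms by (auto simp: bounded_operator_def)
  interpret bounded_linear A by fact
  show "A (f + g) = A f + A g" "A 0 = 0" "A (f - g) = A f - A g" 
    "A (sum h F) = (\<Sum>x\<in>F. A (h x))"
    by (rule add zero diff sum)+
qed

lemma bounded_operator_bound:
  assumes "bounded_operator A"
  obtains K where "0 \<le> K" "\<And>f. norm (A f) \<le> K * norm f"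
  using bounded_linear.nonneg_bounded[OF bounded_operatorD(1)[OF assms]]
  by (metis mult.commute)

lemma bounded_operator_comp:
  assumes A: "bounded_operator A" and B: "bounded_operator B"
  shows "bounded_operator (A \<circ> B)"
  using bounded_linear_compose[OF bounded_operatorD(1)[OF A] bounded_operatorD(1)[OF B]]
  by (simp add: bounded_operator_def bounded_operatorD[OF A] bounded_operatorD[OF B] o_def)

lemma norm_L2_abs:
  assumes "square_integrable f"
  shows "(norm (abs_L2 f))\<^sup>2 = (\<integral>t. (cmod (f t))\<^sup>2 \<partial>lborel)"
proof -
  have "complex_of_real ((norm (abs_L2 f))\<^sup>2) = (\<integral>t. f t * cnj (f t) \<partial>lborel)"
    unfolding cinner_self[symmetric] by (rule cinner.abs_eq) (simp_all add: assms ae_eq_refl)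
  also have "\<dots> = of_real (\<integral>t. (cmod (f t))\<^sup>2 \<partial>lborel)"
    by (simp only: complex_norm_square[symmetric] integral_complex_of_real)
  finally show ?thesis unfolding of_real_eq_iff .
qed

lemma L2_cases:
  obtains f where "square_integrable f" "x = abs_L2 f"
proof -
  have "abs_L2 (rep_L2 x) = x" by (rule Quotient3_abs_rep[OF Quotient3_L2])
  moreover have "square_integrable (rep_L2 x)"
    using Quotient3_rep_reflp[OF Quotient3_L2, of x] by (simp add: ae_eq_refl)
  ultimately show ?thesis using that by metis
qed

lemma L2_add_abs:
  "square_integrable f \<Longrightarrow> square_integrable g \<Longrightarrow> abs_L2 f + abs_L2 g = abs_L2 (\<lambda>t. f t + g t)"
  by (rule plus_L2.abs_eq) (auto simp: ae_eq_refl)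

lemma L2_cscale_abs:
  "square_integrable f \<Longrightarrow> cscale c (abs_L2 f) = abs_L2 (\<lambda>t. c * f t)"
  by (rule cscale.abs_eq) (auto simp: ae_eq_refl)

lemma L2_cinner_abs:
  "square_integrable f \<Longrightarrow> square_integrable g \<Longrightarrow>
    cinner (abs_L2 f) (abs_L2 g) = (\<integral>t. f t * cnj (g t) \<partial>lborel)"
  by (rule cinner.abs_eq) (auto simp: ae_eq_refl)

lemma L2_diff_abs:
  assumes "square_integrable f" "square_integrable g"
  shows "abs_L2 f - abs_L2 g = abs_L2 (\<lambda>t. f t - g t)" "square_integrable (\<lambda>t. f t - g t)"
proof -
  have "abs_L2 f - abs_L2 g = abs_L2 f + cscale (-1) (abs_L2 g)"
    unfolding minus_L2_def uminus_L2_def ..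
  also have "\<dots> = abs_L2 (\<lambda>t. f t + (-1) * g t)"
    by (simp only: L2_cscale_abs[OF assms(2)] L2_add_abs[OF assms(1) square_integrable_scale[OF assms(2)]])
  finally show "abs_L2 f - abs_L2 g = abs_L2 (\<lambda>t. f t - g t)"
    by simp
  show "square_integrable (\<lambda>t. f t - g t)"
    using square_integrable_add[OF assms(1) square_integrable_scale[OF assms(2), of "-1"]] by simp
qed

lemma L2_sum_abs:
  assumes "\<And>i. i \<in> F \<Longrightarrow> square_integrable (f i)"
  shows "(\<Sum>i\<in>F. abs_L2 (f i)) = abs_L2 (\<lambda>t. \<Sum>i\<in>F. f i t) \<and> square_integrable (\<lambda>t. \<Sum>i\<in>F. f i t)"
  using assms
proof (induction F rule: infinite_finite_induct)
  case (insert x F)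
  then show ?case by (simp add: L2_add_abs square_integrable_add)
qed (auto simp: zero_L2_def square_integrable_zero)

subsection \<open>Completeness\<close>

text \<open>Dominated convergence for the squared distance. The majorant is asked of the difference,
  so it may come from the size of \<open>h\<close> alone or from a common bounded support.\<close>

lemma L2_tendsto_dominated:
  fixes f :: "nat \<Rightarrow> real^'d::finite \<Rightarrow> complex"
  assumes f: "\<And>n. square_integrable (f n)" and h: "square_integrable h"
    and lim: "AE t in lborel. (\<lambda>n. f n t) \<longlonglongrightarrow> h t"
    and bound: "\<And>n. AE t in lborel. (cmod (h t - f n t))\<^sup>2 \<le> w t" and w: "integrable lborel w"
  shows "(\<lambda>n. abs_L2 (f n)) \<longlonglongrightarrow> abs_L2 h"
proof -
  have [measurable]: "f n \<in> borel_measurable borel" "h \<in> borel_measurable borel" for n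
    using f[of n] h by (simp_all add: square_integrable_def)
  have "(\<lambda>n. \<integral>t. (cmod (h t - f n t))\<^sup>2 \<partial>lborel) \<longlonglongrightarrow> (\<integral>t. 0 \<partial>(lborel :: (real^'d) measure))"
  proof (rule integral_dominated_convergence[where w=w])
    show "AE t in lborel. (\<lambda>n. (cmod (h t - f n t))\<^sup>2) \<longlonglongrightarrow> 0"
      using lim
    proof eventually_elim
      case (elim t)
      then have "(\<lambda>n. (cmod (h t - f n t))\<^sup>2) \<longlonglongrightarrow> (cmod (h t - h t))\<^sup>2"
        by (intro tendsto_intros)
      then show ?case by simp
    qed
    show "AE t in lborel. norm ((cmod (h t - f n t))\<^sup>2) \<le> w t" for n
      using bound[of n] by eventually_elim simp
  qed (use w in auto)
  moreover have "(\<integral>t. (cmod (h t - f n t))\<^sup>2 \<partial>lborel) = (norm (abs_L2 h - abs_L2 (f n)))\<^sup>2" for n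
    unfolding L2_diff_abs(1)[OF h f] by (rule norm_L2_abs[symmetric, OF L2_diff_abs(2)[OF h f]])
  ultimately have "(\<lambda>n. sqrt ((norm (abs_L2 h - abs_L2 (f n)))\<^sup>2)) \<longlonglongrightarrow> sqrt 0"
    by (intro tendsto_real_sqrt) simp
  then have "(\<lambda>n. norm (abs_L2 (f n) - abs_L2 h)) \<longlonglongrightarrow> 0"
    by (simp add: norm_minus_commute)
  then show ?thesis by (rule LIM_zero_cancel[OF tendsto_norm_zero_cancel])
qed

text \<open>Riesz--Fischer: the sums of moduli increase to a square-integrable majorant.\<close>

lemma L2_summable:
  fixes F :: "nat \<Rightarrow> 'd::finite L2"
  assumes "summable (\<lambda>n. norm (F n))"
  shows "summable F"
proof -
  have "\<exists>f. square_integrable f \<and> F n = abs_L2 f" for n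
    using L2_cases by metis
  then obtain f where f: "\<And>n. square_integrable (f n)" "\<And>n. F n = abs_L2 (f n)"
    by metis
  have [measurable]: "f n \<in> borel_measurable borel" for n
    using f(1)[of n] by (simp add: square_integrable_def)
  define M where "M = (\<Sum>n. norm (F n))"
  define G where "G n t = (\<Sum>i<n. cmod (f i t))" for n t
  have G_meas[measurable]: "G n \<in> borel_measurable borel" for n
    unfolding G_def by measurable
  have cm: "square_integrable (\<lambda>t. complex_of_real (cmod (f i t)))"
    "norm (abs_L2 (\<lambda>t. complex_of_real (cmod (f i t)))) = norm (F i)" for i
  proof -
    show s: "square_integrable (\<lambda>t. complex_of_real (cmod (f i t)))"
      using f(1)[of i] by (auto simp: square_integrable_def)
    have "(norm (abs_L2 (\<lambda>t. complex_of_real (cmod (f i t)))))\<^sup>2 = (norm (F i))\<^sup>2"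
      using norm_L2_abs[OF s] norm_L2_abs[OF f(1)[of i]] f(2)[of i] by simp
    then show "norm (abs_L2 (\<lambda>t. complex_of_real (cmod (f i t)))) = norm (F i)"
      by (simp add: power2_eq_iff_nonneg)
  qed
  have G: "integrable lborel (\<lambda>t. (G n t)\<^sup>2) \<and> (\<integral>t. (G n t)\<^sup>2 \<partial>lborel) \<le> M\<^sup>2" for n
  proof -
    let ?h = "\<lambda>i t. complex_of_real (cmod (f i t))"
    have eq: "(\<Sum>i<n. abs_L2 (?h i)) = abs_L2 (\<lambda>t. \<Sum>i<n. ?h i t)" 
      and sq: "square_integrable (\<lambda>t. \<Sum>i<n. ?h i t)"
      using L2_sum_abs[of "{..<n}" ?h] cm(1) by auto
    have sum_eq: "(\<Sum>i<n. ?h i t) = complex_of_real (G n t)" for t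
      by (simp add: G_def)
    have "norm (abs_L2 (\<lambda>t. \<Sum>i<n. ?h i t)) \<le> (\<Sum>i<n. norm (F i))"
      unfolding eq[symmetric] using norm_sum[of "\<lambda>i. abs_L2 (?h i)" "{..<n}"] by (simp add: cm(2))
    also have "\<dots> \<le> M" unfolding M_def by (rule sum_le_suminf[OF assms]) auto
    finally have "(norm (abs_L2 (\<lambda>t. \<Sum>i<n. ?h i t)))\<^sup>2 \<le> M\<^sup>2"
      by (rule power_mono) simp
    then show ?thesis
      unfolding norm_L2_abs[OF sq] using sq unfolding sum_eq square_integrable_def
      by simp
  qed
  have inc: "incseq (\<lambda>n. ennreal ((G n t)\<^sup>2))" for t
    unfolding G_def
    by (intro incseq_SucI ennreal_leI power_mono sum_nonneg) auto
  have "(\<integral>\<^sup>+t. (SUP n. ennreal ((G n t)\<^sup>2)) \<partial>lborel) = (SUP n. \<integral>\<^sup>+t. ennreal ((G n t)\<^sup>2) \<partial>lborel)"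
    by (rule nn_integral_monotone_convergence_SUP) 
      (use inc in \<open>auto simp: incseq_def le_fun_def\<close>)
  also have "\<dots> \<le> ennreal (M\<^sup>2)"
    using G by (intro SUP_least) (simp add: nn_integral_eq_integral ennreal_leI)
  finally have fin: "(\<integral>\<^sup>+t. (SUP n. ennreal ((G n t)\<^sup>2)) \<partial>lborel) \<le> ennreal (M\<^sup>2)" .
  then have "(\<integral>\<^sup>+t. (SUP n. ennreal ((G n t)\<^sup>2)) \<partial>lborel) \<noteq> \<infinity>"
    using ennreal_less_top[of "M\<^sup>2"] by (auto simp: top_unique)
  then have ae: "AE t in lborel. (SUP n. ennreal ((G n t)\<^sup>2)) \<noteq> \<infinity>"
    by (intro nn_integral_noteq_infinite) auto
  \<comment> \<open>\<open>enn2real\<close> sends infinity to 0, which happens only on the null set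
    excluded by \<open>ae\<close>.\<close>
  define H where "H t = enn2real (SUP n. ennreal ((G n t)\<^sup>2))" for t
  have H_meas[measurable]: "H \<in> borel_measurable borel" unfolding H_def by measurable
  have H_int: "integrable lborel H"
  proof (rule integrableI_bounded)
    show "(\<integral>\<^sup>+t. ennreal (norm (H t)) \<partial>lborel) < \<infinity>"
    proof (rule le_less_trans)
      show "(\<integral>\<^sup>+t. ennreal (norm (H t)) \<partial>lborel) \<le> (\<integral>\<^sup>+t. (SUP n. ennreal ((G n t)\<^sup>2)) \<partial>lborel)"
        unfolding H_def by (intro nn_integral_mono) (simp add: ennreal_enn2real_if)
      show "(\<integral>\<^sup>+t. (SUP n. ennreal ((G n t)\<^sup>2)) \<partial>lborel) < \<infinity>"
        using fin by (simp add: le_less_trans)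
    qed
  qed simp
  have bound: "AE t in lborel. \<forall>n. (G n t)\<^sup>2 \<le> H t"
    using ae
  proof eventually_elim
    case (elim t)
    show ?case
    proof
      fix n
      have "ennreal ((G n t)\<^sup>2) \<le> (SUP n. ennreal ((G n t)\<^sup>2))" by (rule SUP_upper) simp
      also have "\<dots> = ennreal (H t)" 
        unfolding H_def using elim
        by (intro ennreal_enn2real[symmetric]) (simp only: less_top infinity_ennreal_def)
      finally show "(G n t)\<^sup>2 \<le> H t" by (simp add: H_def)
    qed
  qed
  have conv: "AE t in lborel. summable (\<lambda>i. f i t)"
    using bound
  proof eventually_elim
    case (elim t)
    have "(\<Sum>i\<le>n. norm (f i t)) \<le> sqrt (H t)" for n
      using elim unfolding lessThan_Suc_atMost[symmetric] by (intro real_le_rsqrt) (simp only: G_def)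
    then show ?case
      by (intro summable_norm_cancel[OF bounded_imp_summable]) auto
  qed
  define h where "h t = (\<Sum>i. f i t)" for t
  have [measurable]: "h \<in> borel_measurable borel"
    unfolding h_def by measurable
  \<comment> \<open>The limit and every partial sum have modulus at most \<open>sqrt (H t)\<close>,
    so their difference has at most twice that; squaring gives the 4.\<close>
  have tail: "AE t in lborel. (\<forall>n. (cmod (h t - (\<Sum>i<n. f i t)))\<^sup>2 \<le> 4 * H t) \<and> (cmod (h t))\<^sup>2 \<le> H t
      \<and> (\<lambda>n. \<Sum>i<n. f i t) \<longlonglongrightarrow> h t"
    using bound conv
  proof eventually_elim
    case (elim t)
    have lim: "(\<lambda>n. \<Sum>i<n. f i t) \<longlonglongrightarrow> h t"
      using elim(2) unfolding h_def by (rule summable_LIMSEQ)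
    have part: "cmod (\<Sum>i<n. f i t) \<le> sqrt (H t)" for n
    proof -
      have "cmod (\<Sum>i<n. f i t) \<le> G n t" unfolding G_def by (rule norm_sum)
      also have "\<dots> \<le> sqrt (H t)" using elim(1) by (intro real_le_rsqrt) auto
      finally show ?thesis .
    qed
    have hb: "cmod (h t) \<le> sqrt (H t)"
      by (rule LIMSEQ_le_const2[OF tendsto_norm[OF lim]]) (use part in auto)
    have H0: "0 \<le> H t" by (simp add: H_def)
    have "(cmod (h t - (\<Sum>i<n. f i t)))\<^sup>2 \<le> (2 * sqrt (H t))\<^sup>2" for n
      using norm_triangle_ineq4[of "h t" "\<Sum>i<n. f i t"] part[of n] hb by (intro power_mono) auto
    moreover have "(cmod (h t))\<^sup>2 \<le> (sqrt (H t))\<^sup>2"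
      using hb by (intro power_mono) auto
    ultimately show ?case using lim H0 by (simp add: power_mult_distrib)
  qed
  have h_sq: "square_integrable h"
    unfolding square_integrable_def
  proof
    show "integrable lborel (\<lambda>t. (cmod (h t))\<^sup>2)"
    proof (rule Bochner_Integration.integrable_bound[OF H_int])
      show "AE t in lborel. norm ((cmod (h t))\<^sup>2) \<le> norm (H t)"
        using tail by eventually_elim auto
    qed simp
  qed simp
  have part: "(\<Sum>i<n. F i) = abs_L2 (\<lambda>t. \<Sum>i<n. f i t)" "square_integrable (\<lambda>t. \<Sum>i<n. f i t)" for n
    using L2_sum_abs[of "{..<n}" f] f by auto
  have "(\<lambda>n. abs_L2 (\<lambda>t. \<Sum>i<n. f i t)) \<longlonglongrightarrow> abs_L2 h"
  proof (rule L2_tendsto_dominated[OF part(2) h_sq])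
    show "AE t in lborel. (\<lambda>n. \<Sum>i<n. f i t) \<longlonglongrightarrow> h t"
      using tail by eventually_elim simp
    show "AE t in lborel. (cmod (h t - (\<Sum>i<n. f i t)))\<^sup>2 \<le> 4 * H t" for n
      using tail by eventually_elim simp
  qed (use H_int in simp)
  then have "F sums abs_L2 h"
    by (simp add: sums_def part(1))
  then show ?thesis by (rule sums_summable)
qed

text \<open>
  The Riesz vector minimises \<open>\<parallel>f\<parallel>\<^sup>2 / 2 - \<phi> f\<close>; by the parallelogram law a minimising sequence
  with geometrically decreasing excess has summable increments.
\<close>

lemma L2_riesz:
  fixes \<phi> :: "'d::finite L2 \<Rightarrow> real"
  assumes "bounded_linear \<phi>"
  shows "\<exists>g. \<forall>f. \<phi> f = inner f g"
proof -
  interpret \<phi>: bounded_linear \<phi> by fact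
  obtain K where K: "\<And>f. \<bar>\<phi> f\<bar> \<le> norm f * K"
    using \<phi>.bounded by auto
  define N where "N f = (norm f)\<^sup>2 / 2 - \<phi> f" for f
  have lower: "- K\<^sup>2 / 2 \<le> N f" for f
  proof -
    have "0 \<le> (norm f - K)\<^sup>2" by simp
    then have "norm f * K \<le> (norm f)\<^sup>2 / 2 + K\<^sup>2 / 2" by (simp add: power2_diff)
    with K[of f] show ?thesis unfolding N_def by linarith
  qed
  define m where "m = (INF f. N f)"
  have bdd: "bdd_below (range N)" using lower by (auto simp: bdd_below_def)
  have m: "m \<le> N f" for f
    unfolding m_def by (rule cINF_lower[OF bdd]) simp
  have "\<exists>f. N f < m + (1/4) ^ n" for n
    using cInf_lessD[of "range N" "m + (1/4) ^ n"] by (auto simp: m_def)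
  then obtain f where f: "\<And>n. N (f n) < m + (1/4) ^ n" by metis
  \<comment> \<open>The linear part of \<open>N\<close> cancels between the two points and their
    midpoint, leaving the parallelogram law.\<close>
  have par: "(norm (a - b))\<^sup>2 = 4 * (N a + N b - 2 * N ((1/2) *\<^sub>R (a + b)))" for a b
    unfolding N_def
    by (simp add: power2_norm_eq_inner \<phi>.add \<phi>.scaleR inner_add_left inner_add_right
        inner_diff_left inner_diff_right inner_commute[of b a] field_simps)
  \<comment> \<open>The two excesses add up to at most \<open>2 * (1/4) ^ n\<close>, and
    \<open>par\<close> multiplies by 4. The resulting 8 is rounded up to 9 to have an exact square
    root.\<close>
  have step: "norm (f (Suc n) - f n) \<le> 3 * (1/2) ^ n" for n
  proof (rule power2_le_imp_le)
    have p: "0 \<le> (1/4 :: real) ^ n" by simp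
    have "N (f (Suc n)) + N (f n) - 2 * N ((1/2) *\<^sub>R (f (Suc n) + f n)) \<le> 2 * (1/4) ^ n"
      using f[of "Suc n"] f[of n] m[of "(1/2) *\<^sub>R (f (Suc n) + f n)"]
p
      unfolding power_Suc by linarith
    then have "(norm (f (Suc n) - f n))\<^sup>2 \<le> 8 * (1/4) ^ n"
      unfolding par by simp
    also have "\<dots> \<le> 9 * (1/4) ^ n" by simp
    also have "\<dots> = (3 * (1/2) ^ n)\<^sup>2"
      by (simp add: power_mult_distrib flip: power_mult power2_eq_square)
         (simp add: power_mult mult.commute[of n] power2_eq_square)
    finally show "(norm (f (Suc n) - f n))\<^sup>2 \<le> (3 * (1/2) ^ n)\<^sup>2" .
  qed simp
  have "summable (\<lambda>n. f (Suc n) - f n)"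
  proof (rule L2_summable[OF summable_comparison_test])
    show "summable (\<lambda>n. 3 * (1/2) ^ n :: real)" by (intro summable_mult summable_geometric) simp
    show "\<exists>M. \<forall>n\<ge>M. norm (norm (f (Suc n) - f n)) \<le> 3 * (1/2) ^ n"
      using step by auto
  qed
  then obtain l where "(\<lambda>n. \<Sum>i<n. f (Suc i) - f i) \<longlonglongrightarrow> l"
    by (auto simp: summable_def sums_def)
  then have "(\<lambda>n. (f n - f 0) + f 0) \<longlonglongrightarrow> l + f 0"
    unfolding sum_lessThan_telescope by (intro tendsto_add tendsto_const)
  then have lim: "f \<longlonglongrightarrow> l + f 0" by simp
  define g where "g = l + f 0"
  have "(\<lambda>n. N (f n)) \<longlonglongrightarrow> N g"
    unfolding N_def g_def by (intro tendsto_intros \<phi>.tendsto lim) simp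
  moreover have "(\<lambda>n. m + (1/4) ^ n) \<longlonglongrightarrow> m + 0"
    by (intro tendsto_intros LIMSEQ_power_zero) simp
  ultimately have "N g \<le> m + 0"
    by (rule LIMSEQ_le) (use f less_imp_le in blast)
  then have g: "N g \<le> N f" for f using m[of f] by simp
  have "\<phi> h = inner h g" for h
  proof (cases "h = 0")
    case False
    define c where "c = inner g h - \<phi> h"
    \<comment> \<open>\<open>c\<close> is the derivative of \<open>N\<close> at \<open>g\<close> in
      direction \<open>h\<close>, and this \<open>t\<close> minimises the quadratic
      \<open>N (g + t *\<^sub>R h)\<close>; minimality of \<open>g\<close> then forces
      \<open>c = 0\<close>.\<close>
    define t where "t = - c / (norm h)\<^sup>2"
    have "N g \<le> N (g + t *\<^sub>R h)" by (rule g)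
    moreover have "(norm (g + t *\<^sub>R h))\<^sup>2 = (norm g)\<^sup>2 + 2 * t * inner g h + t\<^sup>2 * (norm h)\<^sup>2"
      unfolding power2_norm_eq_inner
      by (simp add: inner_add_left inner_add_right inner_commute[of h g] power2_eq_square algebra_simps)
    ultimately have "0 \<le> t * c + t\<^sup>2 * (norm h)\<^sup>2 / 2"
      unfolding N_def c_def by (simp add: \<phi>.add \<phi>.scaleR algebra_simps)
    also have "t * c + t\<^sup>2 * (norm h)\<^sup>2 / 2 = - c\<^sup>2 / (2 * (norm h)\<^sup>2)"
      using False by (simp add: t_def field_simps power2_eq_square)
    finally have "c\<^sup>2 \<le> 0" using False by (simp add: divide_le_0_iff field_simps)
    then show ?thesis by (simp add: c_def inner_commute)
  qed simp
  then show ?thesis by blast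
qed

section \<open>Existence of adjoints\<close>

lemma Im_cinner: "Im (cinner f g) = - inner (cscale \<i> f) g"
  by (simp add: inner_L2_def cinner_cscale_left)

text \<open>Riesz representation is real, so it yields only the real part of the adjoint relation.
  The imaginary part is the real part at \<open>cscale \<i> f\<close>, since \<open>A\<close>
  commutes with \<open>\<i>\<close>.\<close>

lemma adj_exists:
  assumes A: "bounded_operator A"
  shows "\<exists>B. bounded_operator B \<and> (\<forall>f g. cinner (A f) g = cinner f (B g))"
proof -
  note A' = bounded_operatorD[OF A]
  have "\<exists>b. \<forall>f. inner (A f) g = inner f b" for g
    by (rule L2_riesz) (rule bounded_linear_compose[OF bounded_linear_inner_left A'(1)])
  then obtain B where B: "\<And>f g. inner (A f) g = inner f (B g)" by metis
  have adj: "cinner (A f) g = cinner f (B g)" for f g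
  proof (rule complex_eqI)
    show "Re (cinner (A f) g) = Re (cinner f (B g))"
      using B[of f g] by (simp add: inner_L2_def)
    show "Im (cinner (A f) g) = Im (cinner f (B g))"
      using B[of "cscale \<i> f" g] by (simp add: Im_cinner A'(2))
  qed
  obtain K where K: "0 \<le> K" "\<And>f. norm (A f) \<le> K * norm f"
    using bounded_operator_bound[OF A] by blast
  have "bounded_operator B"
  proof (rule bounded_operatorI[where K=K])
    show "B (f + g) = B f + B g" for f g
      by (rule cinner_eqI') (simp add: cinner_add_right flip: adj)
    show "B (cscale c f) = cscale c (B f)" for c f
      by (rule cinner_eqI') (simp add: cinner_cscale_right flip: adj)
    fix f
    have "(norm (B f))\<^sup>2 = inner (A (B f)) f"
      by (simp add: B power2_norm_eq_inner)
    also have "\<dots> \<le> norm (A (B f)) * norm f" by (rule norm_cauchy_schwarz)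
    also have "\<dots> \<le> (K * norm (B f)) * norm f" by (intro mult_right_mono K) simp
    finally have "norm (B f) * norm (B f) \<le> norm (B f) * (norm f * K)"
      by (simp add: power2_eq_square mult_ac)
    then show "norm (B f) \<le> norm f * K"
      using K(1) by (cases "B f = 0") auto
  qed
  with adj show ?thesis by blast
qed

lemma adj_operator:
  assumes A: "bounded_operator A"
  shows "bounded_operator (adj A)" "cinner (adj A f) g = cinner f (A g)"
    "cinner f (adj A g) = cinner (A f) g"
proof -
  obtain B where B: "bounded_operator B" "\<And>f g. cinner (A f) g = cinner f (B g)"
    using adj_exists[OF A] by blast
  have eq: "adj A = B" by (rule adj_eqI[OF B])
  show "bounded_operator (adj A)" using B eq by simp
  show "cinner f (adj A g) = cinner (A f) g" unfolding eq by (simp add: B(2))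
  have "cinner (adj A f) g = cnj (cinner g (B f))" unfolding eq by (rule cinner_commute)
  also have "\<dots> = cnj (cinner (A g) f)" by (simp add: B(2))
  also have "\<dots> = cinner f (A g)" by (rule cinner_commute[symmetric])
  finally show "cinner (adj A f) g = cinner f (A g)" .
qed

subsection \<open>Positive operators\<close>

lemma positive_operatorD:
  assumes "positive_operator P"
  shows "bounded_operator P" "cinner (P f) f \<in> \<real>" "0 \<le> Re (cinner (P f) f)"
    "cinner (P f) f = of_real (Re (cinner (P f) f))"
  using assms by (auto simp: positive_operator_def)

text \<open>A complex sesquilinear form that is real on the diagonal is hermitian: its values at
  \<open>f + g\<close> and \<open>f + cscale \<i> g\<close> fix the imaginary and the real part of
  the off-diagonal entries.\<close>

lemma positive_operator_sym:
  assumes "positive_operator P"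
  shows "cinner (P f) g = cinner f (P g)"
proof -
  note P = bounded_operatorD[OF positive_operatorD(1)[OF assms]]
  have im: "Im (cinner (P h) h) = 0" for h
    using positive_operatorD(2)[OF assms, of h] by (simp add: complex_is_Real_iff)
  have "Im (cinner (P f) g + cinner (P g) f) = 0"
    using im[of "f + g"] im[of f] im[of g] by (simp add: P cinner_add_left cinner_add_right)
  moreover have "Im (- \<i> * cinner (P f) g + \<i> * cinner (P g) f) = 0"
    using im[of "f + cscale \<i> g"] im[of f] im[of g]
    by (simp add: P cinner_add_left cinner_add_right cinner_cscale_left cinner_cscale_right)
  ultimately have "cinner (P f) g = cnj (cinner (P g) f)"
    by (simp add: complex_eq_iff)
  then show ?thesis by (simp only: cinner_commute[of f "P g"])
qed

lemma positive_operator_cauchy_schwarz: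
  assumes "positive_operator P"
  shows "(cmod (cinner (P f) g))\<^sup>2 \<le> Re (cinner (P f) f) * Re (cinner (P g) g)"
proof -
  note P = bounded_operatorD[OF positive_operatorD(1)[OF assms]]
  define w where "w = cinner (P f) g"
  define a where "a = Re (cinner (P f) f)"
  define b where "b = Re (cinner (P g) g)"
  have Pg: "cinner (P g) f = cnj w"
    unfolding w_def positive_operator_sym[OF assms, of g f] by (rule cinner_commute)
  have a: "cinner (P f) f = of_real a" and b: "cinner (P g) g = of_real b"
    unfolding a_def b_def by (rule positive_operatorD(4)[OF assms])+
  have quad: "0 \<le> a - 2 * t * (cmod w)\<^sup>2 + t\<^sup>2 * (cmod w)\<^sup>2 * b" for t
  proof -
    \<comment> \<open>Including \<open>w\<close> itself rather than its phase makes both cross terms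
      equal to \<open>- t * (cmod w)\<^sup>2\<close>, hence real, with no division by
      \<open>cmod w\<close>.\<close>
    define c where "c = - of_real t * w"
    have "cinner (P (f + cscale c g)) (f + cscale c g)
        = cinner (P f) f + cnj c * w + c * cnj w + c * cnj c * cinner (P g) g"
      by (simp add: P cinner_add_left cinner_add_right cinner_cscale_left cinner_cscale_right
          Pg flip: w_def) (simp add: algebra_simps)
    also have "\<dots> = of_real a - 2 * of_real t * (w * cnj w) + (of_real t)\<^sup>2 * (w * cnj w) * of_real b"
      by (simp add: c_def power2_eq_square algebra_simps a b)
    also have "\<dots> = of_real (a - 2 * t * (cmod w)\<^sup>2 + t\<^sup>2 * (cmod w)\<^sup>2 * b)"
      unfolding complex_norm_square[symmetric] by simp
    finally show ?thesis
      using positive_operatorD(3)[OF assms, of "f + cscale c g"] by simp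
  qed
  have "(cmod w)\<^sup>2 \<le> a * b"
  proof (cases "b = 0")
    case True
    have "(cmod w)\<^sup>2 \<le> 0"
    proof (rule ccontr)
      assume "\<not> (cmod w)\<^sup>2 \<le> 0"
      then show False
        \<comment> \<open>With \<open>b = 0\<close> the expression is affine in \<open>t\<close>;
          this \<open>t\<close> gives it the value -1.\<close>
        using quad[of "(a + 1) / (2 * (cmod w)\<^sup>2)"] True by simp
    qed
    then show ?thesis using True by simp
  next
    case False
    then have "0 < b" using positive_operatorD(3)[OF assms, of g] by (simp add: b_def)
    then show ?thesis
      using quad[of "1 / b"] by (simp add: field_simps power2_eq_square)
  qed
  then show ?thesis by (simp add: w_def a_def b_def)
qed

text \<open>Cauchy-Schwarz for the form of \<open>P\<close> at \<open>f\<close> and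
  \<open>P f\<close> bounds the fourth power of \<open>norm (P f)\<close>; cancelling its square
  leaves the claim. It turns a common bound on quadratic forms into a common operator bound.\<close>

lemma positive_operator_norm_le:
  assumes P: "positive_operator P" and M: "\<And>f. Re (cinner (P f) f) \<le> M * (norm f)\<^sup>2"
  shows "norm (P f) \<le> M * norm f"
proof (cases "f = 0")
  case True
  then show ?thesis using bounded_operatorD(4)[OF positive_operatorD(1)[OF P]] by simp
next
  case False
  have "0 \<le> M * (norm f)\<^sup>2" using M[of f] positive_operatorD(3)[OF P, of f] by linarith
  then have M0: "0 \<le> M" using False by (simp add: zero_le_mult_iff)
  have c: "cmod (cinner (P f) (P f)) = (norm (P f))\<^sup>2"
    unfolding cinner_self by (simp del: of_real_power)
  have "(norm (P f))\<^sup>2 * (norm (P f))\<^sup>2 = (cmod (cinner (P f) (P f)))\<^sup>2"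
    unfolding c by (rule power2_eq_square[symmetric])
  also have "\<dots> \<le> Re (cinner (P f) f) * Re (cinner (P (P f)) (P f))"
    by (rule positive_operator_cauchy_schwarz[OF P])
  also have "\<dots> \<le> (M * (norm f)\<^sup>2) * (M * (norm (P f))\<^sup>2)"
    by (intro mult_mono M positive_operatorD(3)[OF P] mult_nonneg_nonneg M0) auto
  also have "\<dots> = (M * norm f)\<^sup>2 * (norm (P f))\<^sup>2"
    by (simp only: power2_eq_square mult_ac)
  finally have "(norm (P f))\<^sup>2 \<le> (M * norm f)\<^sup>2"
    by (cases "P f = 0") (simp, simp only: mult_le_cancel_right, simp)
  then show ?thesis by (rule power2_le_imp_le) (simp add: M0)
qed

subsection \<open>Nuclear decomposition of trace class operators\<close>

text \<open>
  Subtracting \<open>v \<otimes> v\<close> with \<open>v = P e / \<langle>P e, e\<rangle>\<^sup>1\<^sup>/\<^sup>2\<close> keeps \<open>P\<close> positive and makes it vanish at \<open>e\<close>.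
  Running through a basis yields \<open>P = \<Sum> v\<^sub>k \<otimes> v\<^sub>k\<close> with \<open>\<Sum> \<parallel>v\<^sub>k\<parallel>\<^sup>2 \<le> tr P\<close>, without square roots or
  spectral theory. If \<open>\<langle>P e, e\<rangle> = 0\<close>, then \<open>P e = 0\<close>, so the division by zero is harmless.
\<close>

definition cholesky_vector :: "('d::finite L2 \<Rightarrow> 'd L2) \<Rightarrow> 'd L2 \<Rightarrow> 'd L2" where
  "cholesky_vector P e = cscale (1 / sqrt (Re (cinner (P e) e))) (P e)"

definition cholesky_step :: "('d::finite L2 \<Rightarrow> 'd L2) \<Rightarrow> 'd L2 \<Rightarrow> 'd L2 \<Rightarrow> 'd L2" where
  "cholesky_step P e f = P f - cscale (cinner f (cholesky_vector P e)) (cholesky_vector P e)"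

lemma bounded_operator_rank_one: "bounded_operator (\<lambda>f. cscale (cinner f v) u)"
proof (rule bounded_operatorI[where K="norm v * norm u"])
  show "norm (cscale (cinner f v) u) \<le> norm f * (norm v * norm u)" for f
    using mult_right_mono[OF cmod_cinner_le[of f v] norm_ge_zero[of u]]
    by (simp add: norm_cscale mult_ac)
qed (simp_all add: cinner_add_left cinner_cscale_left L2.scale_left_distrib)

lemma bounded_operator_diff:
  assumes "bounded_operator A" "bounded_operator B"
  shows "bounded_operator (\<lambda>f. A f - B f)"
  using bounded_linear_sub[OF bounded_operatorD(1)[OF assms(1)] bounded_operatorD(1)[OF assms(2)]]
  by (simp add: bounded_operator_def bounded_operatorD[OF assms(1)] bounded_operatorD[OF assms(2)]
      cscale.diff_right)

lemma cholesky_form: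
  "cinner (cholesky_step P e f) f = cinner (P f) f - of_real ((cmod (cinner f (cholesky_vector P e)))\<^sup>2)"
proof -
  have "cinner (cholesky_vector P e) f = cnj (cinner f (cholesky_vector P e))"
    by (rule cinner_commute)
  then show ?thesis
    by (simp only: cholesky_step_def cinner.diff_left cinner_cscale_left complex_norm_square)
qed

text \<open>The subtracted form is
  \<open>(cmod (cinner (P f) e))\<^sup>2 / Re (cinner (P e) e)\<close>, which Cauchy-Schwarz for the
  form of \<open>P\<close> bounds by \<open>Re (cinner (P f) f)\<close>.\<close>

lemma cholesky_step_positive:
  assumes P: "positive_operator P"
  shows "positive_operator (cholesky_step P e)"
proof -
  let ?s = "Re (cinner (P e) e)"
  have s: "0 \<le> ?s" by (rule positive_operatorD(3)[OF P])
  have "cinner f (cholesky_vector P e) = cinner (P f) e / of_real (sqrt ?s)" for f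
    by (simp add: cholesky_vector_def cinner_cscale_right positive_operator_sym[OF P, of f])
  then have "(cmod (cinner f (cholesky_vector P e)))\<^sup>2 = (cmod (cinner (P f) e))\<^sup>2 / ?s" for f
    using s by (simp add: norm_divide power_divide)
  also have "\<dots>f \<le> Re (cinner (P f) f)" for f
    using positive_operator_cauchy_schwarz[OF P, of f e] positive_operatorD(3)[OF P, of f] s
    by (cases "?s = 0") (auto simp: divide_le_eq)
  finally have "(cmod (cinner f (cholesky_vector P e)))\<^sup>2 \<le> Re (cinner (P f) f)" for f .
  moreover have "bounded_operator (cholesky_step P e)"
    unfolding cholesky_step_def
    by (intro bounded_operator_diff positive_operatorD(1)[OF P] bounded_operator_rank_one)
  ultimately show ?thesis
    unfolding positive_operator_def cholesky_form
    using positive_operatorD(2)[OF P] by (auto simp del: of_real_power)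
qed

lemma cholesky_step_self:
  assumes P: "positive_operator P"
  shows "cholesky_step P e e = 0"
proof -
  define s where "s = Re (cinner (P e) e)"
  have s: "0 \<le> s" unfolding s_def by (rule positive_operatorD(3)[OF P])
  have e: "cinner e (P e) = of_real s"
    unfolding s_def positive_operator_sym[OF P, symmetric] by (rule positive_operatorD(4)[OF P])
  show ?thesis
  proof (cases "s = 0")
    case True
    have "(cmod (cinner (P e) (P e)))\<^sup>2 \<le> 0"
      using positive_operator_cauchy_schwarz[OF P, of e "P e"] True by (simp add: s_def)
    then have "P e = 0" by (simp add: cinner_self)
    then show ?thesis by (simp add: cholesky_step_def cholesky_vector_def)
  next
    case False
    have "cscale (cinner e (cholesky_vector P e)) (cholesky_vector P e)
        = cscale (of_real (s / (sqrt s * sqrt s))) (P e)"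
      by (simp add: cholesky_vector_def cinner_cscale_right e flip: s_def of_real_mult of_real_divide)
    also have "\<dots> = P e" using s False by simp
    finally show ?thesis by (simp add: cholesky_step_def)
  qed
qed

text \<open>Symmetry gives \<open>cinner f (P e) = cinner (P f) e = 0\<close>, so the subtracted
  term vanishes at \<open>f\<close>. Basis vectors already eliminated therefore stay
  eliminated.\<close>

lemma cholesky_step_zero:
  assumes P: "positive_operator P" and "P f = 0"
  shows "cholesky_step P e f = 0"
proof -
  have "cinner f (P e) = 0"
    using positive_operator_sym[OF P, of f e] assms(2) by (simp add: cinner.zero_left)
  then show ?thesis
    by (simp add: cholesky_step_def cholesky_vector_def cinner_cscale_right assms(2))
qed

text \<open>Linearity extends convergence from \<open>E\<close> to its span, and the uniform bound
  extends it to the closure. It replaces any operator-norm control of the Cholesky residuals, which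
  need only tend to 0 pointwise.\<close>

lemma strong_convergence_dense:
  fixes A :: "nat \<Rightarrow> 'd::finite L2 \<Rightarrow> 'd L2"
  assumes A: "\<And>n. bounded_operator (A n)" "\<And>n f. norm (A n f) \<le> M * norm f"
    and E: "closure (cspan E) = UNIV" "\<And>e. e \<in> E \<Longrightarrow> (\<lambda>n. A n e) \<longlonglongrightarrow> 0"
  shows "(\<lambda>n. A n f) \<longlonglongrightarrow> 0"
proof (rule LIMSEQ_I)
  fix r :: real assume "0 < r"
  \<comment> \<open>\<open>\<bar>M\<bar> + 1\<close> dominates \<open>M\<close> and is positive, so
    the division is safe and the far part costs at most \<open>r / 2\<close>.\<close>
  define d where "d = r / (2 * (\<bar>M\<bar> + 1))"
  have "0 < d" using \<open>0 < r\<close> by (simp add: d_def)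
  have "f \<in> closure (cspan E)" by (simp add: E(1))
  then obtain h where h: "h \<in> cspan E" "dist h f < d"
    using \<open>0 < d\<close> closure_approachable by blast
  obtain F c where F: "finite F" "F \<subseteq> E" "h = (\<Sum>e\<in>F. cscale (c e) e)"
    using cspan_finite_sum[OF h(1)] by blast
  have "(\<lambda>n. \<Sum>e\<in>F. cscale (c e) (A n e)) \<longlonglongrightarrow> (\<Sum>e\<in>F. cscale (c e) 0)"
    using F(2) E(2) by (intro tendsto_sum cscale.tendsto tendsto_const) auto
  then have "(\<lambda>n. A n h) \<longlonglongrightarrow> 0"
    unfolding F(3) by (simp add: bounded_operatorD[OF A(1)] cscale.zero_right)
  then obtain N where N: "\<And>n. n \<ge> N \<Longrightarrow> norm (A n h) < r / 2"
    using LIMSEQ_D[of "\<lambda>n. A n h" 0 "r/2"] \<open>0 < r\<close> by auto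
  have "norm (A n f) < r" if "n \<ge> N" for n
  proof -
    have "norm (A n f) \<le> norm (A n (f - h)) + norm (A n h)"
      using norm_triangle_ineq[of "A n (f - h)" "A n h"] by (simp add: bounded_operatorD[OF A(1)])
    moreover have "norm (A n (f - h)) \<le> (\<bar>M\<bar> + 1) * d"
    proof (rule order_trans[OF A(2)], rule mult_mono)
      show "norm (f - h) \<le> d" using h(2) by (simp add: dist_norm norm_minus_commute)
    qed auto
    moreover have "(\<bar>M\<bar> + 1) * d = r / 2" by (simp add: d_def field_simps)
    ultimately show ?thesis using N[OF that] by linarith
  qed
  then show "\<exists>N. \<forall>n\<ge>N. norm (A n f - 0) < r" by auto
qed

lemma positive_operator_nuclear:
  fixes P :: "'d::finite L2 \<Rightarrow> 'd L2"
  assumes P: "positive_operator P" and E: "orthonormal_basis E"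
    and sum: "(\<lambda>e. cinner (P e) e) summable_on E"
  obtains v w where "\<And>k. v k = P (w k)" "summable (\<lambda>k. (norm (v k))\<^sup>2)"
    "\<And>f. (\<lambda>k. cscale (cinner f (v k)) (v k)) sums P f"
proof -
  \<comment> \<open>Summability makes the support of the diagonal countable, whatever the
    cardinality of \<open>E\<close>. For a basis vector outside \<open>D\<close>, Cauchy-Schwarz
    already gives \<open>P e = 0\<close>.\<close>
  define D where "D = {e\<in>E. cinner (P e) e \<noteq> 0}"
  have "countable D" unfolding D_def by (rule summable_countable_complex[OF sum])
  \<comment> \<open>The enumeration may repeat, and is arbitrary if \<open>D\<close> is empty; this
    does no harm, as a Cholesky step at any vector preserves positivity and earlier zeros.\<close>
  define en where "en = from_nat_into D"
  have en: "D \<subseteq> range en"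
    unfolding en_def by (rule subset_range_from_nat_into[OF \<open>countable D\<close>])
  define Q where "Q = rec_nat P (\<lambda>n Q. cholesky_step Q (en n))"
  have Q0: "Q 0 = P" and QS: "Q (Suc n) = cholesky_step (Q n) (en n)" for n
    by (simp_all add: Q_def)
  define v where "v n = cholesky_vector (Q n) (en n)" for n
  have pos: "positive_operator (Q n)" for n
    by (induction n) (simp_all add: Q0 QS P cholesky_step_positive)
  have QS': "Q (Suc n) f = Q n f - cscale (cinner f (v n)) (v n)" for n f
    by (simp add: QS cholesky_step_def v_def)
  have decomp: "P f = (\<Sum>k<n. cscale (cinner f (v k)) (v k)) + Q n f" for n f
    by (induction n) (simp_all add: Q0 QS')
  have form: "Re (cinner (P f) f) = (\<Sum>k<n. (cmod (cinner f (v k)))\<^sup>2) + Re (cinner (Q n f) f)" for n f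
  proof (induction n)
    case (Suc n)
    then show ?case by (simp add: QS cholesky_form v_def del: of_real_power)
  qed (simp add: Q0)
  have Q_le: "Re (cinner (Q n f) f) \<le> Re (cinner (P f) f)" for n f
    unfolding form[of f n] by (simp add: sum_nonneg)
  have v_le: "(\<Sum>k<n. (cmod (cinner f (v k)))\<^sup>2) \<le> Re (cinner (P f) f)" for n f
    unfolding form[of f n] using positive_operatorD(3)[OF pos, of n f] by simp
  obtain M where M: "0 \<le> M" "\<And>f. norm (P f) \<le> M * norm f"
    using bounded_operator_bound[OF positive_operatorD(1)[OF P]] by blast
  have form_le: "Re (cinner (P f) f) \<le> M * (norm f)\<^sup>2" for f
  proof -
    have "Re (cinner (P f) f) \<le> norm (P f) * norm f"
      using complex_Re_le_cmod[of "cinner (P f) f"] cmod_cinner_le[of "P f" f] by linarith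
    also have "\<dots> \<le> M * norm f * norm f" by (intro mult_right_mono M) simp
    finally show ?thesis by (simp add: power2_eq_square mult_ac)
  qed
  \<comment> \<open>The residual forms only decrease, so one bound \<open>M\<close> for the form of
    \<open>P\<close> serves every residual.\<close>
  have Q_bound: "norm (Q n f) \<le> M * norm f" for n f
    by (rule positive_operator_norm_le[OF pos order_trans[OF Q_le form_le]])
  have Q_zero: "Q m f = 0" if "Q n f = 0" "n \<le> m" for n m f
    using that(2) by (induction rule: dec_induct) (simp_all add: QS that(1) cholesky_step_zero pos)
  have Q_lim_E: "(\<lambda>n. Q n e) \<longlonglongrightarrow> 0" if "e \<in> E" for e
  proof -
    have "\<exists>n. Q n e = 0"
    proof (cases "e \<in> D")
      case True
      then obtain n where "e = en n" using en by auto
      then have "Q (Suc n) e = 0" by (simp add: QS cholesky_step_self pos)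
      then show ?thesis ..
    next
      case False
      then have "cinner (P e) e = 0" using that by (simp add: D_def)
      then have "(cmod (cinner (P e) (P e)))\<^sup>2 \<le> 0"
        using positive_operator_cauchy_schwarz[OF P, of e "P e"] by simp
      then have "Q 0 e = 0" by (simp add: cinner_self Q0)
      then show ?thesis ..
    qed
    then obtain n where "\<And>m. n \<le> m \<Longrightarrow> Q m e = 0" using Q_zero by blast
    then have "\<forall>\<^sub>F m in sequentially. Q m e = 0" by (auto simp: eventually_sequentially)
    then show ?thesis by (rule tendsto_eventually)
  qed
  have Q_lim: "(\<lambda>n. Q n f) \<longlonglongrightarrow> 0" for f
    by (rule strong_convergence_dense[OF positive_operatorD(1)[OF pos] Q_bound _ Q_lim_E])
      (use E in \<open>simp_all add: orthonormal_basis_def\<close>)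
  have sums: "(\<lambda>k. cscale (cinner f (v k)) (v k)) sums P f" for f
  proof -
    have "(\<lambda>n. P f - Q n f) \<longlonglongrightarrow> P f - 0" by (intro tendsto_intros Q_lim)
    moreover have "(\<Sum>k<n. cscale (cinner f (v k)) (v k)) = P f - Q n f" for n
      using decomp[of f n] by simp
    ultimately show ?thesis by (simp add: sums_def)
  qed
  \<comment> \<open>Parseval writes the sum of the squared norms as a basis sum of
    \<open>\<Sum>k<n. (cmod (cinner e (v k)))\<^sup>2\<close>; by \<open>v_le\<close> each entry is
    below the diagonal of \<open>P\<close>, so the trace bounds the partial sums.\<close>
  have "summable (\<lambda>k. (norm (v k))\<^sup>2)"
  proof (rule summableI_nonneg_bounded)
    fix n
    have "((\<lambda>e. \<Sum>k<n. (cmod (cinner (v k) e))\<^sup>2) has_sum (\<Sum>k<n. (norm (v k))\<^sup>2)) E"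
      by (induction n) (simp_all add: has_sum_add has_sum_parseval_norm[OF E])
    moreover have "((\<lambda>e. Re (cinner (P e) e)) has_sum Re (infsum (\<lambda>e. cinner (P e) e) E)) E"
      by (rule has_sum_Re[OF has_sum_infsum[OF sum]])
    ultimately show "(\<Sum>k<n. (norm (v k))\<^sup>2) \<le> Re (infsum (\<lambda>e. cinner (P e) e) E)"
      by (rule has_sum_mono) (simp only: cmod_cinner_commute[of "v _"] v_le)
  qed simp
  \<comment> \<open>\<open>v n\<close> is a multiple of \<open>Q n (en n)\<close>, and
    \<open>Q n\<close> differs from \<open>P\<close> by multiples of earlier vectors, which lie in
    the range of \<open>P\<close> by induction.\<close>
  moreover have "\<exists>w. v n = P w" for n
  proof (induction n rule: less_induct)
    case (less n)
    then obtain w where w: "\<And>k. k < n \<Longrightarrow> v k = P (w k)" by metis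
    note lin = bounded_operatorD[OF positive_operatorD(1)[OF P]]
    have "Q n (en n) = P (en n) - (\<Sum>k<n. cscale (cinner (en n) (v k)) (v k))"
      using decomp[of "en n" n] by simp
    also have "\<dots> = P (en n) - (\<Sum>k<n. cscale (cinner (en n) (v k)) (P (w k)))"
      using w by simp
    also have "\<dots> = P (en n - (\<Sum>k<n. cscale (cinner (en n) (v k)) (w k)))"
      by (simp add: lin)
    finally have "v n = P (cscale (1 / sqrt (Re (cinner (Q n (en n)) (en n))))
        (en n - (\<Sum>k<n. cscale (cinner (en n) (v k)) (w k))))"
      by (simp add: v_def cholesky_vector_def lin(2))
    then show ?case ..
  qed
  then obtain w where "\<And>k. v k = P (w k)" by metis
  ultimately show ?thesis using that sums by blast
qed

text \<open>
  The polar decomposition is avoided: the left vectors are \<open>S w\<^sub>k\<close>, where \<open>v\<^sub>k = \<bar>S\<bar> w\<^sub>k\<close>.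
\<close>

lemma trace_class_nuclear:
  fixes S :: "'d::finite L2 \<Rightarrow> 'd L2"
  assumes "trace_class S"
  obtains u v where "\<And>k. norm (u k) = norm (v k)" "summable (\<lambda>k. (norm (v k))\<^sup>2)"
    "\<And>f. (\<lambda>k. cscale (cinner f (v k)) (u k)) sums S f"
proof -
  obtain P E where S: "bounded_operator S" and P: "positive_operator P"
    and PS: "P \<circ> P = adj S \<circ> S" and E: "orthonormal_basis E"
    and sum: "(\<lambda>e. cinner (P e) e) summable_on E"
    using assms by (auto simp: trace_class_def)
  obtain v w where v: "\<And>k. v k = P (w k)" "summable (\<lambda>k. (norm (v k))\<^sup>2)"
    "\<And>f. (\<lambda>k. cscale (cinner f (v k)) (v k)) sums P f"
    using positive_operator_nuclear[OF P E sum] by blast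
  \<comment> \<open>This isometry between the ranges of \<open>P\<close> and \<open>S\<close> does
    the work of the partial isometry in a polar decomposition.\<close>
  have norm_eq: "norm (S f) = norm (P f)" for f
  proof -
    have "cinner (S f) (S f) = cinner (adj S (S f)) f"
      by (simp add: adj_operator[OF S])
    also have "\<dots> = cinner (P (P f)) f"
      using fun_cong[OF PS, of f] by simp
    also have "\<dots> = cinner (P f) (P f)" by (rule positive_operator_sym[OF P])
    finally have "(norm (S f))\<^sup>2 = (norm (P f))\<^sup>2"
      unfolding cinner_self of_real_eq_iff .
    then show ?thesis by (simp add: power2_eq_iff_nonneg)
  qed
  note S' = bounded_operatorD[OF S] and P' = bounded_operatorD[OF positive_operatorD(1)[OF P]]
  show ?thesis
  proof (rule that[of "\<lambda>k. S (w k)" v])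
    show "norm (S (w k)) = norm (v k)" for k by (simp add: norm_eq v(1))
    show "summable (\<lambda>k. (norm (v k))\<^sup>2)" by (rule v(2))
    fix f
    \<comment> \<open>Both errors are images of the same vector, under \<open>S\<close> and under
      \<open>P\<close>, so the known convergence for \<open>P\<close> carries over.\<close>
    have eq: "norm ((\<Sum>k<n. cscale (cinner f (v k)) (S (w k))) - S f)
        = norm ((\<Sum>k<n. cscale (cinner f (v k)) (v k)) - P f)" for n
    proof -
      have "(\<Sum>k<n. cscale (cinner f (v k)) (S (w k))) - S f
          = S ((\<Sum>k<n. cscale (cinner f (v k)) (w k)) - f)"
        by (simp add: S')
      moreover have "(\<Sum>k<n. cscale (cinner f (v k)) (v k)) - P f
          = P ((\<Sum>k<n. cscale (cinner f (v k)) (w k)) - f)"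
        by (simp add: P' v(1))
      ultimately show ?thesis by (simp only: norm_eq)
    qed
    have "(\<lambda>n. norm ((\<Sum>k<n. cscale (cinner f (v k)) (S (w k))) - S f)) \<longlonglongrightarrow> 0"
      unfolding eq by (rule tendsto_norm_zero[OF LIM_zero[OF v(3)[of f, unfolded sums_def]]])
    then show "(\<lambda>k. cscale (cinner f (v k)) (S (w k))) sums S f"
      unfolding sums_def by (rule LIM_zero_cancel[OF tendsto_norm_zero_cancel])
  qed
qed

text \<open>The double sum over series and basis converges absolutely by
  \<open>parseval_abs\<close>. Summing over the basis first, Parseval leaves a value that no longer
  mentions the basis picked by \<open>SOME\<close>; \<open>E\<close> only witnesses that one
  exists.\<close>

lemma operator_trace_nuclear:
  fixes A :: "'d::finite L2 \<Rightarrow> 'd L2"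
  assumes E: "orthonormal_basis (E :: 'd L2 set)"
    and A: "\<And>f. (\<lambda>k. cscale (cinner f (b k)) (a k)) sums A f"
    and s: "summable (\<lambda>k. norm (a k) * norm (b k))"
  shows "operator_trace A = (\<Sum>k. cinner (a k) (b k))"
proof -
  define B where "B = (SOME E :: 'd L2 set. orthonormal_basis E)"
  have B: "orthonormal_basis B" unfolding B_def by (rule someI[of orthonormal_basis, OF E])
  let ?h = "\<lambda>k e. cinner (a k) e * cinner e (b k)"
  have "(\<lambda>x. norm (case x of (k, e) \<Rightarrow> ?h k e)) summable_on (UNIV \<times> B)"
    unfolding Infinite_Sum.abs_summable_on_Sigma_iff prod.case
  proof (intro conjI ballI)
    show "(\<lambda>e. norm (?h k e)) summable_on B" for k by (rule parseval_abs(1)[OF B])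
    have "summable (\<lambda>k. \<Sum>\<^sub>\<infinity>e\<in>B. norm (?h k e))"
      by (rule summable_comparison_test[OF _ s]) (use parseval_abs(2)[OF B] in \<open>auto simp: infsum_nonneg\<close>)
    then show "(\<lambda>k. norm (\<Sum>\<^sub>\<infinity>e\<in>B. norm (?h k e))) summable_on UNIV"
      by (intro norm_summable_imp_summable_on) (simp add: infsum_nonneg)
  qed
  then have swap: "(\<Sum>\<^sub>\<infinity>k. \<Sum>\<^sub>\<infinity>e\<in>B. ?h k e) = (\<Sum>\<^sub>\<infinity>e\<in>B. \<Sum>\<^sub>\<infinity>k. ?h k e)"
    by (rule infsum_swap_banach[OF Infinite_Sum.abs_summable_summable])
  have cs: "summable (\<lambda>k. norm (cinner (a k) (b k)))"
    by (rule summable_comparison_test[OF _ s]) (auto simp: cmod_cinner_le)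
  have "(\<Sum>\<^sub>\<infinity>k. ?h k e) = cinner (A e) e" for e
  proof (rule infsumI, rule norm_summable_imp_has_sum)
    show "(\<lambda>k. ?h k e) sums cinner (A e) e"
      using bounded_linear.sums[OF cinner.bounded_linear_left A[of e], of e]
      by (simp add: cinner_cscale_left mult.commute)
    show "summable (\<lambda>k. norm (?h k e))"
    proof (rule summable_comparison_test)
      show "\<exists>N. \<forall>k\<ge>N. norm (norm (?h k e)) \<le> (norm e)\<^sup>2 * (norm (a k) * norm (b k))"
        using mult_mono[OF cmod_cinner_le[of "a _" e] cmod_cinner_le[of e "b _"]]
        by (auto simp: norm_mult power2_eq_square mult_ac)
    qed (intro summable_mult s)
  qed
  moreover have "(\<Sum>\<^sub>\<infinity>e\<in>B. ?h k e) = cinner (a k) (b k)" for k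
    by (rule infsumI[OF has_sum_parseval[OF B]])
  moreover have "(\<Sum>\<^sub>\<infinity>k. cinner (a k) (b k)) = (\<Sum>k. cinner (a k) (b k))"
    by (rule infsumI[OF norm_summable_imp_has_sum[OF cs summable_sums[OF summable_norm_cancel[OF cs]]]])
  ultimately show ?thesis
    using swap by (simp add: operator_trace_def flip: B_def)
qed

section \<open>Plancherel's theorem and Moyal's identity\<close>

subsection \<open>Lebesgue integrals on Euclidean space\<close>

text \<open>\<open>lborel\<close> is the image of the product of one-dimensional Lebesgue measures
  under the coordinate map.\<close>

lemma integral_lborel_prod:
  fixes f :: "'a::euclidean_space \<Rightarrow> real \<Rightarrow> complex"
  assumes int: "\<And>b. b \<in> Basis \<Longrightarrow> integrable lborel (f b)"
  shows "integrable lborel (\<lambda>x. \<Prod>b\<in>Basis. f b (x \<bullet> b))"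
    and "(\<integral>x. (\<Prod>b\<in>Basis. f b (x \<bullet> b)) \<partial>lborel) = (\<Prod>b\<in>Basis. \<integral>s. f b s \<partial>lborel)"
proof -
  interpret product_sigma_finite "\<lambda>_::'a. lborel :: real measure" ..
  let ?M = "\<Pi>\<^sub>M b\<in>(Basis :: 'a set). (lborel :: real measure)"
  let ?T = "\<lambda>x. \<Sum>b\<in>(Basis :: 'a set). x b *\<^sub>R b"
  have [measurable]: "f b \<in> borel_measurable borel" if "b \<in> Basis" for b
    using int[OF that] by simp
  have T[measurable]: "?T \<in> measurable ?M borel" by measurable
  have meas: "(\<lambda>x::'a. \<Prod>b\<in>Basis. f b (x \<bullet> b)) \<in> borel_measurable borel" by measurable
  have comp: "(\<Prod>b\<in>Basis. f b (?T x \<bullet> b)) = (\<Prod>b\<in>Basis. f b (x b))" for x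
    by (intro prod.cong) simp_all
  show "integrable lborel (\<lambda>x. \<Prod>b\<in>Basis. f b (x \<bullet> b))"
    unfolding lborel_eq[where 'a='a] integrable_distr_eq[OF T meas] comp
    by (rule product_integrable_prod) (use int in auto)
  show "(\<integral>x. (\<Prod>b\<in>Basis. f b (x \<bullet> b)) \<partial>lborel) = (\<Prod>b\<in>Basis. \<integral>s. f b s \<partial>lborel)"
    unfolding lborel_eq[where 'a='a] integral_distr[OF T meas] comp
    by (rule product_integral_prod) (use int in auto)
qed

text \<open>The scaling is that of the standard normal density, so its Fourier transform comes from
  the known characteristic function.\<close>

definition gauss :: "'a::euclidean_space \<Rightarrow> real" where
  "gauss w = exp (- (norm w)\<^sup>2 / 2)"

lemma gauss_bounds: "0 < gauss w" "gauss w \<le> 1"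
  by (simp_all add: gauss_def)

lemma measurable_gauss [measurable]: "gauss \<in> borel_measurable borel"
  unfolding gauss_def by measurable

text \<open>The integrand factors over coordinates. Each factor is the characteristic function of
  the standard normal distribution times \<open>sqrt (2 * pi)\<close>, which undoes the
  normalisation of the density.\<close>

lemma gauss_fourier:
  fixes y :: "'a::euclidean_space"
  defines "c \<equiv> sqrt (2 * pi) ^ DIM('a)"
  shows "integrable lborel (\<lambda>w::'a. of_real (gauss w) * exp (\<i> * of_real (w \<bullet> y)))"
    and "(\<integral>w. of_real (gauss w) * exp (\<i> * of_real (w \<bullet> y)) \<partial>lborel) = complex_of_real (c * gauss y)"
proof -
  let ?f = "\<lambda>b s. complex_of_real (exp (- s\<^sup>2 / 2)) * exp (\<i> * of_real (s * (y \<bullet> b)))"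
  have dens: "?f b s = sqrt (2 * pi) *\<^sub>R (std_normal_density s *\<^sub>R iexp ((y \<bullet> b) * s))" for b s
    by (simp add: std_normal_density_def scaleR_conv_of_real mult.commute)
  have int: "integrable lborel (?f b)" for b
  proof (rule Bochner_Integration.integrable_bound)
    show "integrable lborel (\<lambda>s. sqrt (2 * pi) * std_normal_density s)"
      using integrable_normal_density[of 1 0] by simp
  qed (auto simp: std_normal_density_def norm_mult)
  have I: "(\<integral>s. ?f b s \<partial>lborel) = of_real (sqrt (2 * pi) * exp (- (y \<bullet> b)\<^sup>2 / 2))" for b
  proof -
    have "(\<integral>s. std_normal_density s *\<^sub>R iexp ((y \<bullet> b) * s) \<partial>lborel) = char std_normal_distribution (y \<bullet> b)"
      unfolding char_def by (subst integral_density) auto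
    also have "\<dots> = exp (- (y \<bullet> b)\<^sup>2 / 2)"
      by (simp add: char_std_normal_distribution)
    finally show ?thesis
      unfolding dens by (simp add: scaleR_conv_of_real)
  qed
  have "(\<Prod>b\<in>Basis. ?f b (w \<bullet> b)) = of_real (gauss w) * exp (\<i> * of_real (w \<bullet> y))" for w :: 'a
  proof -
    have "(\<Prod>b\<in>Basis. ?f b (w \<bullet> b)) = of_real (exp (\<Sum>b\<in>Basis. - (w \<bullet> b)\<^sup>2 / 2))
        * exp (\<Sum>b\<in>Basis. \<i> * of_real ((w \<bullet> b) * (y \<bullet> b)))"
      by (simp add: prod.distrib exp_sum)
    also have "(\<Sum>b\<in>Basis. - (w \<bullet> b)\<^sup>2 / 2) = - (norm w)\<^sup>2 / 2"
      unfolding norm_eq_sqrt_inner euclidean_inner[of w w]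
      by (simp add: sum_nonneg sum_negf power2_eq_square flip: sum_divide_distrib)
    also have "(\<Sum>b\<in>Basis. \<i> * of_real ((w \<bullet> b) * (y \<bullet> b))) = \<i> * of_real (w \<bullet> y)"
      unfolding euclidean_inner[of w y] by (simp add: sum_distrib_left)
    finally show ?thesis by (simp add: gauss_def)
  qed
  moreover have "(\<Prod>b\<in>Basis. complex_of_real (sqrt (2 * pi) * exp (- (y \<bullet> b)\<^sup>2 / 2))) = of_real (c * gauss y)"
  proof -
    have "(\<Prod>b\<in>Basis. sqrt (2 * pi) * exp (- (y \<bullet> b)\<^sup>2 / 2)) = c * exp (\<Sum>b\<in>Basis. - (y \<bullet> b)\<^sup>2 / 2)"
      by (simp add: prod.distrib exp_sum c_def)
    also have "(\<Sum>b\<in>Basis. - (y \<bullet> b)\<^sup>2 / 2) = - (norm y)\<^sup>2 / 2"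
      unfolding norm_eq_sqrt_inner euclidean_inner[of y y]
      by (simp add: sum_nonneg sum_negf power2_eq_square flip: sum_divide_distrib)
    finally show ?thesis unfolding of_real_prod[symmetric] gauss_def by (simp only:)
  qed
  ultimately show "integrable lborel (\<lambda>w::'a. of_real (gauss w) * exp (\<i> * of_real (w \<bullet> y)))"
    and "(\<integral>w. of_real (gauss w) * exp (\<i> * of_real (w \<bullet> y)) \<partial>lborel) = complex_of_real (c * gauss y)"
    using integral_lborel_prod[of ?f] int I by simp_all
qed

lemma integrable_gauss: "integrable lborel (gauss :: 'a::euclidean_space \<Rightarrow> real)"
  and integral_gauss: "(\<integral>w. gauss (w::'a) \<partial>lborel) = sqrt (2 * pi) ^ DIM('a::euclidean_space)"
proof -
  show "integrable lborel (gauss :: 'a \<Rightarrow> real)"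
    using integrable_Re[OF gauss_fourier(1)[of "0 :: 'a"]] by simp
  have "complex_of_real (\<integral>w. gauss (w::'a) \<partial>lborel) = of_real (sqrt (2 * pi) ^ DIM('a))"
    using gauss_fourier(2)[of "0 :: 'a"] by (simp add: gauss_def del: of_real_power)
  then show "(\<integral>w. gauss (w::'a) \<partial>lborel) = sqrt (2 * pi) ^ DIM('a)"
    unfolding of_real_eq_iff .
qed

section \<open>Affine substitution and product integrands\<close>

lemma integral_lborel_affine:
  fixes f :: "'a::euclidean_space \<Rightarrow> 'b::{banach, second_countable_topology}"
  assumes [measurable]: "f \<in> borel_measurable borel" and "c \<noteq> 0"
  shows "(\<integral>x. f x \<partial>lborel) = (\<bar>c\<bar> ^ DIM('a)) *\<^sub>R (\<integral>x. f (t + c *\<^sub>R x) \<partial>lborel)"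
proof -
  have "(\<integral>x. f x \<partial>lborel)
      = (\<integral>x. f x \<partial>density (distr lborel borel (\<lambda>x. t + c *\<^sub>R x)) (\<lambda>_. ennreal (\<bar>c\<bar> ^ DIM('a))))"
    by (subst lborel_affine[OF assms(2), of t]) (rule refl)
  also have "\<dots> = (\<integral>x. (\<bar>c\<bar> ^ DIM('a)) *\<^sub>R f x \<partial>distr lborel borel (\<lambda>x. t + c *\<^sub>R x))"
    by (intro integral_density) auto
  also have "\<dots> = (\<bar>c\<bar> ^ DIM('a)) *\<^sub>R (\<integral>x. f (t + c *\<^sub>R x) \<partial>lborel)"
    by (subst integral_distr) auto
  finally show ?thesis .
qed

lemma integrable_lborel_affine:
  fixes f :: "'a::euclidean_space \<Rightarrow> 'b::{banach, second_countable_topology}"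
  assumes f: "integrable lborel f" and "c \<noteq> 0"
  shows "integrable lborel (\<lambda>x. f (t + c *\<^sub>R x))"
proof -
  have [measurable]: "f \<in> borel_measurable borel" using f by simp
  have "integrable (density (distr lborel borel (\<lambda>x. t + c *\<^sub>R x)) (\<lambda>_. ennreal (\<bar>c\<bar> ^ DIM('a)))) f"
    using f by (subst (asm) lborel_affine[OF assms(2), of t])
  then have "integrable (distr lborel borel (\<lambda>x. t + c *\<^sub>R x)) (\<lambda>x. (\<bar>c\<bar> ^ DIM('a)) *\<^sub>R f x)"
    by (subst (asm) integrable_density) auto
  then have "integrable lborel (\<lambda>x. (\<bar>c\<bar> ^ DIM('a)) *\<^sub>R f (t + c *\<^sub>R x))"
    by (subst (asm) integrable_distr_eq) auto
  then have "integrable lborel (\<lambda>x. inverse (\<bar>c\<bar> ^ DIM('a)) *\<^sub>R (\<bar>c\<bar> ^ DIM('a)) *\<^sub>R f (t + c *\<^sub>R x))"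
    by (rule integrable_scaleR_right)
  then show ?thesis using assms(2) by simp
qed

lemma integrable_mult_pair:
  fixes f :: "'a::euclidean_space \<Rightarrow> complex" and g :: "'b::euclidean_space \<Rightarrow> complex"
  assumes f: "integrable lborel f" and g: "integrable lborel g"
  shows "integrable (lborel \<Otimes>\<^sub>M lborel) (\<lambda>(x, y). f x * g y)"
proof -
  have [measurable]: "f \<in> borel_measurable borel" "g \<in> borel_measurable borel"
    using f g by simp_all
  show ?thesis
  proof (rule lborel_pair.Fubini_integrable)
    show "integrable lborel (\<lambda>x. \<integral>y. norm (case (x, y) of (x, y) \<Rightarrow> f x * g y) \<partial>lborel)"
      using f by (simp add: norm_mult)
    show "AE x in lborel. integrable lborel (\<lambda>y. case (x, y) of (x, y) \<Rightarrow> f x * g y)"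
      using g by simp
  qed measurable
qed

subsection \<open>Time-frequency shifts\<close>

lemma time_freq_shift_abs:
  assumes "square_integrable f"
  shows "time_freq_shift (x, \<omega>) (abs_L2 f)
      = abs_L2 (\<lambda>t. exp (2 * pi * \<i> * complex_of_real (\<omega> \<bullet> t)) * f (t - x))"
    and "square_integrable (\<lambda>t. exp (2 * pi * \<i> * complex_of_real (\<omega> \<bullet> t)) * f (t - x))"
proof -
  show "time_freq_shift (x, \<omega>) (abs_L2 f)
      = abs_L2 (\<lambda>t. exp (2 * pi * \<i> * complex_of_real (\<omega> \<bullet> t)) * f (t - x))"
    using assms by (subst time_freq_shift.abs_eq) (simp_all add: ae_eq_refl)
  have [measurable]: "f \<in> borel_measurable borel"
    using assms by (simp add: square_integrable_def)
  have "integrable lborel (\<lambda>t. (cmod (f (- x + 1 *\<^sub>R t)))\<^sup>2)"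
    using assms by (intro integrable_lborel_affine) (simp_all add: square_integrable_def)
  then show "square_integrable (\<lambda>t. exp (2 * pi * \<i> * complex_of_real (\<omega> \<bullet> t)) * f (t - x))"
    by (simp add: square_integrable_def norm_mult)
qed

lemma cinner_time_freq_shift: "cinner (time_freq_shift z f) (time_freq_shift z g) = cinner f g"
proof -
  obtain x \<omega> where z: "z = (x, \<omega>)" by fastforce
  obtain f' where f: "square_integrable f'" "f = abs_L2 f'" by (rule L2_cases)
  obtain g' where g: "square_integrable g'" "g = abs_L2 g'" by (rule L2_cases)
  have [measurable]: "f' \<in> borel_measurable borel" "g' \<in> borel_measurable borel"
    using f g by (simp_all add: square_integrable_def)
  let ?e = "\<lambda>t. exp (2 * pi * \<i> * complex_of_real (\<omega> \<bullet> t))"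
  have unit: "?e t * cnj (?e t) = 1" for t
    unfolding complex_norm_square[symmetric] by simp
  have "cinner (time_freq_shift z f) (time_freq_shift z g)
      = (\<integral>t. (?e t * f' (t - x)) * cnj (?e t * g' (t - x)) \<partial>lborel)"
    unfolding z f(2) g(2) time_freq_shift_abs(1)[OF f(1)] time_freq_shift_abs(1)[OF g(1)]
    by (rule L2_cinner_abs[OF time_freq_shift_abs(2)[OF f(1)] time_freq_shift_abs(2)[OF g(1)]])
  also have "\<dots> = (\<integral>t. (?e t * cnj (?e t)) * (f' (t - x) * cnj (g' (t - x))) \<partial>lborel)"
    by (simp only: complex_cnj_mult mult_ac)
  also have "\<dots> = (\<integral>t. f' (- x + 1 *\<^sub>R t) * cnj (g' (- x + 1 *\<^sub>R t)) \<partial>lborel)"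
    unfolding unit by simp
  also have "\<dots> = (\<integral>t. f' t * cnj (g' t) \<partial>lborel)"
    using integral_lborel_affine[of "\<lambda>t. f' t * cnj (g' t)" 1 "- x"] by simp
  also have "\<dots> = cinner f g"
    unfolding f(2) g(2) by (rule L2_cinner_abs[symmetric, OF f(1) g(1)])
  finally show ?thesis .
qed

lemma norm_time_freq_shift [simp]: "norm (time_freq_shift z f) = norm f"
  by (simp add: norm_eq_sqrt_inner inner_L2_def cinner_time_freq_shift)

lemma time_freq_shift_add: "time_freq_shift z (f + g) = time_freq_shift z f + time_freq_shift z g"
proof -
  obtain x \<omega> where z: "z = (x, \<omega>)" by fastforce
  obtain f' where f: "square_integrable f'" "f = abs_L2 f'" by (rule L2_cases)
  obtain g' where g: "square_integrable g'" "g = abs_L2 g'" by (rule L2_cases)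
  show ?thesis
    unfolding z f(2) g(2) L2_add_abs[OF f(1) g(1)] time_freq_shift_abs(1)[OF f(1)]
      time_freq_shift_abs(1)[OF g(1)] time_freq_shift_abs(1)[OF square_integrable_add[OF f(1) g(1)]]
      L2_add_abs[OF time_freq_shift_abs(2)[OF f(1)] time_freq_shift_abs(2)[OF g(1)]]
      distrib_left ..
qed

lemma time_freq_shift_cscale: "time_freq_shift z (cscale c f) = cscale c (time_freq_shift z f)"
proof -
  obtain x \<omega> where z: "z = (x, \<omega>)" by fastforce
  obtain f' where f: "square_integrable f'" "f = abs_L2 f'" by (rule L2_cases)
  show ?thesis
    unfolding z f(2) L2_cscale_abs[OF f(1)] time_freq_shift_abs(1)[OF f(1)]
      time_freq_shift_abs(1)[OF square_integrable_scale[OF f(1)]]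
      L2_cscale_abs[OF time_freq_shift_abs(2)[OF f(1)]]
    by (simp only: mult.left_commute)
qed

lemma bounded_operator_time_freq_shift: "bounded_operator (time_freq_shift z)"
  by (rule bounded_operatorI[where K=1]) (simp_all add: time_freq_shift_add time_freq_shift_cscale)

lemma time_freq_shift_comp:
  "time_freq_shift (x, \<omega>) (time_freq_shift (y, \<eta>) f)
    = cscale (exp (- 2 * pi * \<i> * complex_of_real (\<eta> \<bullet> x))) (time_freq_shift (x + y, \<omega> + \<eta>) f)"
proof -
  obtain f' where f: "square_integrable f'" "f = abs_L2 f'" by (rule L2_cases)
  have "exp (2 * pi * \<i> * complex_of_real (\<omega> \<bullet> t)) * (exp (2 * pi * \<i> * complex_of_real (\<eta> \<bullet> (t - x))) * f' (t - x - y))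
    = exp (- 2 * pi * \<i> * complex_of_real (\<eta> \<bullet> x)) * (exp (2 * pi * \<i> * complex_of_real ((\<omega> + \<eta>) \<bullet> t)) * f' (t - (x + y)))" for t
    by (simp add: inner_diff_right inner_add_left algebra_simps exp_add exp_diff exp_minus)
      (simp add: field_simps)
  then show ?thesis
    unfolding f(2) using f(1)
    by (simp only: time_freq_shift_abs L2_cscale_abs)
qed

text \<open>Either order gives the shift by \<open>z + z'\<close> up to a phase; the quotient of the
  two phases is the symplectic character.\<close>

lemma time_freq_shift_commute:
  "time_freq_shift z (time_freq_shift z' f)
    = cscale (exp (2 * pi * \<i> * complex_of_real (symplectic_form z z'))) (time_freq_shift z' (time_freq_shift z f))"
proof -
  obtain x \<omega> where z: "z = (x, \<omega>)" by fastforce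
  obtain y \<eta> where z': "z' = (y, \<eta>)" by fastforce
  have "exp (- 2 * pi * \<i> * complex_of_real (\<eta> \<bullet> x))
      = exp (2 * pi * \<i> * complex_of_real (\<omega> \<bullet> y - \<eta> \<bullet> x)) * exp (- 2 * pi * \<i> * complex_of_real (\<omega> \<bullet> y))"
    by (simp add: algebra_simps flip: exp_add)
  then show ?thesis
    unfolding z z' time_freq_shift_comp symplectic_form_def
    by (simp add: add.commute)
qed

subsection \<open>Continuity of translations\<close>

lemma integrable_indicator_cball: "integrable lborel (\<lambda>t::'a::euclidean_space. K * indicator (cball 0 R) t :: real)"
  by (intro integrable_mult_right integrable_real_indicator) (use emeasure_bounded_finite[OF bounded_cball, of 0 R] in simp_all)

lemma square_integrable_bounded_support:
  assumes [measurable]: "g \<in> borel_measurable borel"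
    and "\<And>t. cmod (g t) \<le> M" "\<And>t. R < norm t \<Longrightarrow> g t = 0"
  shows "square_integrable g"
  unfolding square_integrable_def
proof
  show "integrable lborel (\<lambda>t. (cmod (g t))\<^sup>2)"
  proof (rule Bochner_Integration.integrable_bound[OF integrable_indicator_cball[of "M\<^sup>2" R]])
    show "AE t in lborel. norm ((cmod (g t))\<^sup>2) \<le> norm (M\<^sup>2 * indicator (cball 0 R) t :: real)"
      using assms(2,3) by (intro AE_I2) (auto simp: indicator_def not_le power_mono)
  qed simp
qed simp

text \<open>A measurable function is an almost everywhere limit of continuous ones. Clipping their
  values to a disc and cutting off their support, both continuously, supplies the majorant for
  dominated convergence.\<close>

lemma continuous_dense_bounded:
  fixes k :: "real^'d::finite \<Rightarrow> complex"
  assumes [measurable]: "k \<in> borel_measurable borel"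
    and M: "\<And>t. cmod (k t) \<le> M" and R: "\<And>t. R < norm t \<Longrightarrow> k t = 0"
  obtains g where "\<And>n. continuous_on UNIV (g n)" "\<And>n t. cmod (g n t) \<le> M"
    "\<And>n t. R + 1 < norm t \<Longrightarrow> g n t = 0" "(\<lambda>n. abs_L2 (g n)) \<longlonglongrightarrow> abs_L2 k"
proof -
  have M0: "0 \<le> M" using M[of 0] norm_ge_zero[of "k 0"] by linarith
  have "k measurable_on UNIV"
    by (rule lebesgue_measurable_imp_measurable_on) (simp_all add: measurable_completion)
  then obtain N f where N: "negligible N" and f: "\<And>n. continuous_on UNIV (f n)"
    and lim: "\<And>t. t \<notin> N \<Longrightarrow> (\<lambda>n. f n t) \<longlonglongrightarrow> k t"
    by (auto simp: measurable_on_def)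
  \<comment> \<open>This cutoff is 1 on the ball of radius \<open>R\<close> and 0 beyond
    \<open>R + 1\<close>. The nearest-point map \<open>?p\<close> fixes the values of
    \<open>k\<close>, so neither modification changes the limit.\<close>
  let ?c = "\<lambda>t::real^'d. max 0 (min 1 (R + 1 - norm t))"
  let ?p = "closest_point (cball 0 M) :: complex \<Rightarrow> complex"
  have cont_p: "continuous_on UNIV ?p"
    by (rule continuous_on_closest_point) (use M0 in auto)
  define g where "g n t = of_real (?c t) * ?p (f n t)" for n t
  have pM: "cmod (?p z) \<le> M" for z
    using closest_point_in_set[of "cball 0 M" z] M0 by simp
  have g_cont: "continuous_on UNIV (g n)" for n
    unfolding g_def
    by (intro continuous_intros continuous_on_compose2[OF cont_p f]) auto
  have g_M: "cmod (g n t) \<le> M" for n t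
  proof -
    have "cmod (g n t) = ?c t * cmod (?p (f n t))"
      by (simp add: g_def norm_mult)
    also have "\<dots> \<le> 1 * M" by (intro mult_mono pM) auto
    finally show ?thesis by simp
  qed
  have g_R: "g n t = 0" if "R + 1 < norm t" for n t
    using that by (simp add: g_def max_def min_def)
  have g_lim: "(\<lambda>n. g n t) \<longlonglongrightarrow> k t" if "t \<notin> N" for t
  proof -
    have "isCont ?p (k t)" using cont_p by (simp add: continuous_on_eq_continuous_at)
    then have "(\<lambda>n. ?p (f n t)) \<longlonglongrightarrow> ?p (k t)"
      by (rule isCont_tendsto_compose) (rule lim[OF that])
    then have "(\<lambda>n. g n t) \<longlonglongrightarrow> of_real (?c t) * ?p (k t)"
      unfolding g_def by (intro tendsto_intros)
    also have "?p (k t) = k t" using M[of t] by (intro closest_point_self) simp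
    also have "of_real (?c t) * k t = k t"
      using R[of t] by (cases "norm t \<le> R") auto
    finally show ?thesis .
  qed
  have [measurable]: "g n \<in> borel_measurable borel" for n
    by (rule borel_measurable_continuous_onI[OF g_cont])
  have g_sq: "square_integrable (g n)" for n
    by (rule square_integrable_bounded_support[OF _ g_M g_R]) auto
  have k_sq: "square_integrable k"
    by (rule square_integrable_bounded_support[OF _ M R]) auto
  have "AE t in lebesgue. (\<lambda>n. g n t) \<longlonglongrightarrow> k t"
    by (rule AE_I'[where N=N]) (use N g_lim in \<open>auto simp: negligible_iff_null_sets\<close>)
  then have ae: "AE t in lborel. (\<lambda>n. g n t) \<longlonglongrightarrow> k t"
    by (simp add: AE_completion_iff)
  have "(\<lambda>n. abs_L2 (g n)) \<longlonglongrightarrow> abs_L2 k"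
  proof (rule L2_tendsto_dominated[OF g_sq k_sq ae AE_I2 integrable_indicator_cball])
    fix n t
    show "(cmod (k t - g n t))\<^sup>2 \<le> (2 * M)\<^sup>2 * indicator (cball 0 (R + 1)) t"
    proof (cases "norm t \<le> R + 1")
      case True
      have "cmod (k t - g n t) \<le> 2 * M"
        using norm_triangle_ineq4[of "k t" "g n t"] M[of t] g_M[of n t] by linarith
      then have "(cmod (k t - g n t))\<^sup>2 \<le> (2 * M)\<^sup>2" by (rule power_mono) simp
      with True show ?thesis by simp
    next
      case False
      then show ?thesis using R[of t] g_R[of t n] by simp
    qed
  qed
  with that g_cont g_M g_R show ?thesis by blast
qed

text \<open>Truncating a representative in size and support reduces this to the bounded case; each
  of the two approximations costs \<open>\<epsilon> / 2\<close>.\<close>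

lemma continuous_dense:
  fixes H :: "'d::finite L2"
  assumes "0 < \<epsilon>"
  obtains g M R where "continuous_on UNIV g" "\<And>t. cmod (g t) \<le> M" "\<And>t. R < norm t \<Longrightarrow> g t = 0"
    "norm (H - abs_L2 g) < \<epsilon>"
proof -
  obtain h where h: "square_integrable h" "H = abs_L2 h" by (rule L2_cases)
  have [measurable]: "h \<in> borel_measurable borel"
    using h by (simp add: square_integrable_def)
  define k where "k n t = (if cmod (h t) \<le> real n \<and> norm t \<le> real n then h t else 0)" for n t
  have k_meas[measurable]: "k n \<in> borel_measurable borel" for n
    unfolding k_def by measurable
  have k_M: "cmod (k n t) \<le> real n" and k_R: "real n < norm t \<Longrightarrow> k n t = 0" for n t
    by (auto simp: k_def)
  have "(\<lambda>n. abs_L2 (k n)) \<longlonglongrightarrow> abs_L2 h"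
  proof (rule L2_tendsto_dominated[OF _ h(1) AE_I2 AE_I2])
    show "square_integrable (k n)" for n
      by (rule square_integrable_bounded_support[OF k_meas k_M k_R])
    show "integrable lborel (\<lambda>t. (cmod (h t))\<^sup>2)"
      using h by (simp add: square_integrable_def)
    show "(cmod (h t - k n t))\<^sup>2 \<le> (cmod (h t))\<^sup>2" for n t
      by (simp add: k_def)
    fix t
    obtain m where m: "max (cmod (h t)) (norm t) \<le> real m" using real_arch_simple by blast
    have "\<forall>\<^sub>F n in sequentially. k n t = h t"
      unfolding eventually_sequentially
      by (rule exI[of _ m]) (use m in \<open>auto simp: k_def\<close>)
    then show "(\<lambda>n. k n t) \<longlonglongrightarrow> h t" by (rule tendsto_eventually)
  qed
  then obtain n where n: "norm (abs_L2 (k n) - H) < \<epsilon> / 2"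
    using LIMSEQ_D[of _ _ "\<epsilon> / 2"] assms h(2) by (metis half_gt_zero order_refl)
  obtain g where g: "\<And>m. continuous_on UNIV (g m)" "\<And>m t. cmod (g m t) \<le> real n"
    "\<And>m t. real n + 1 < norm t \<Longrightarrow> g m t = 0" "(\<lambda>m. abs_L2 (g m)) \<longlonglongrightarrow> abs_L2 (k n)"
    using continuous_dense_bounded[OF k_meas k_M k_R] by blast
  then obtain m where m: "norm (abs_L2 (g m) - abs_L2 (k n)) < \<epsilon> / 2"
    using LIMSEQ_D[of _ _ "\<epsilon> / 2"] assms by (metis half_gt_zero order_refl)
  have "norm (H - abs_L2 (g m)) < \<epsilon>"
    using norm_triangle_ineq[of "abs_L2 (g m) - abs_L2 (k n)" "abs_L2 (k n) - H"] n m
    by (simp add: norm_minus_commute[of H])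
  with that g(1-3) show ?thesis by blast
qed

text \<open>Translations are isometries, so up to two errors of size \<open>\<epsilon> / 3\<close>
  the vector may be taken continuous with bounded support. There the shifts converge pointwise
  inside a common ball.\<close>

lemma translation_continuous:
  fixes H :: "'d::finite L2" and y :: "nat \<Rightarrow> real^'d"
  assumes y: "y \<longlonglongrightarrow> 0"
  shows "(\<lambda>n. time_freq_shift (y n, 0) H) \<longlonglongrightarrow> H"
proof (rule LIMSEQ_I)
  fix \<epsilon> :: real assume "0 < \<epsilon>"
  then have "0 < \<epsilon> / 3" by simp
  then obtain g M R where g: "continuous_on UNIV g" and M: "\<And>t. cmod (g t) \<le> M"
    and R: "\<And>t. R < norm t \<Longrightarrow> g t = 0" and close: "norm (H - abs_L2 g) < \<epsilon> / 3"
    using continuous_dense[of "\<epsilon> / 3" H] by blast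
  have [measurable]: "g \<in> borel_measurable borel"
    by (rule borel_measurable_continuous_onI[OF g])
  have g_sq: "square_integrable g"
    by (rule square_integrable_bounded_support[OF _ M R]) auto
  have shift: "time_freq_shift (y n, 0) (abs_L2 g) = abs_L2 (\<lambda>t. g (t - y n))"
    and shift_sq: "square_integrable (\<lambda>t. g (t - y n))" for n
    using time_freq_shift_abs[OF g_sq, where x="y n" and \<omega>=0] by simp_all
  obtain K where K: "\<And>n. norm (y n) \<le> K"
    using Bseq_def convergent_imp_Bseq convergentI[OF y] by metis
  have "(\<lambda>n. abs_L2 (\<lambda>t. g (t - y n))) \<longlonglongrightarrow> abs_L2 g"
  proof (rule L2_tendsto_dominated[OF shift_sq g_sq AE_I2 AE_I2 integrable_indicator_cball])
    fix t
    have "(\<lambda>n. t - y n) \<longlonglongrightarrow> t - 0" by (intro tendsto_intros y)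
    moreover have "isCont g (t - 0)" using g by (simp add: continuous_on_eq_continuous_at)
    ultimately have "(\<lambda>n. g (t - y n)) \<longlonglongrightarrow> g (t - 0)"
      by (rule isCont_tendsto_compose[rotated])
    then show "(\<lambda>n. g (t - y n)) \<longlonglongrightarrow> g t" by simp
    fix n
    show "(cmod (g t - g (t - y n)))\<^sup>2 \<le> (2 * M)\<^sup>2 * indicator (cball 0 (R + K)) t"
    proof (cases "norm t \<le> R + K")
      case True
      have "cmod (g t - g (t - y n)) \<le> 2 * M"
        using norm_triangle_ineq4[of "g t" "g (t - y n)"] M[of t] M[of "t - y n"] by linarith
      then have "(cmod (g t - g (t - y n)))\<^sup>2 \<le> (2 * M)\<^sup>2" by (rule power_mono) simp
      with True show ?thesis by simp
    next
      case False
      moreover have "0 \<le> K" using K[of 0] norm_ge_zero[of "y 0"] by linarith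
      moreover have "norm t \<le> norm (t - y n) + norm (y n)"
        using norm_triangle_ineq[of "t - y n" "y n"] by simp
      ultimately show ?thesis using R[of t] R[of "t - y n"] K[of n] by simp
    qed
  qed
  then obtain m where m: "\<And>n. m \<le> n \<Longrightarrow> norm (abs_L2 (\<lambda>t. g (t - y n)) - abs_L2 g) < \<epsilon> / 3"
    using LIMSEQ_D[of _ _ "\<epsilon> / 3"] \<open>0 < \<epsilon> / 3\<close> by metis
  have "norm (time_freq_shift (y n, 0) H - H) < \<epsilon>" if "m \<le> n" for n
  proof -
    let ?G = "abs_L2 g"
    have "time_freq_shift (y n, 0) H - H
        = time_freq_shift (y n, 0) (H - ?G) + ((time_freq_shift (y n, 0) ?G - ?G) - (H - ?G))"
      by (simp add: bounded_operatorD[OF bounded_operator_time_freq_shift])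
    also have "norm \<dots> \<le> norm (H - ?G) + (norm (time_freq_shift (y n, 0) ?G - ?G) + norm (H - ?G))"
      by (intro norm_triangle_le order_refl add_mono norm_triangle_ineq4) simp
    also have "\<dots> < \<epsilon>" using close m[OF that] unfolding shift by linarith
    finally show ?thesis .
  qed
  then show "\<exists>m. \<forall>n\<ge>m. norm (time_freq_shift (y n, 0) H - H) < \<epsilon>" by blast
qed

subsection \<open>Plancherel's theorem\<close>

text \<open>The sign of the exponent is that of the modulation in \<open>time_freq_shift\<close>, so
  for fixed \<open>x\<close> a matrix coefficient is exactly this transform of
  \<open>u (t - x) * cnj (p t)\<close>.\<close>

definition fourier :: "(real^'d::finite \<Rightarrow> complex) \<Rightarrow> real^'d \<Rightarrow> complex" where
  "fourier h \<omega> = (\<integral>t. exp (2 * pi * \<i> * complex_of_real (\<omega> \<bullet> t)) * h t \<partial>lborel)"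

lemma measurable_fourier [measurable]:
  assumes [measurable]: "h \<in> borel_measurable borel"
  shows "fourier h \<in> borel_measurable borel"
  unfolding fourier_def[abs_def] by measurable

lemma integral_mult_pair:
  fixes f :: "'a::euclidean_space \<Rightarrow> complex" and g :: "'b::euclidean_space \<Rightarrow> complex"
  assumes f: "integrable lborel f" and g: "integrable lborel g"
  shows "(\<integral>p. f (fst p) * g (snd p) \<partial>lborel) = (\<integral>x. f x \<partial>lborel) * (\<integral>y. g y \<partial>lborel)"
  using lborel_pair.integral_fst[OF integrable_mult_pair[OF f g]]
  by (simp add: lborel_prod case_prod_unfold)

text \<open>
  The Gaussian makes Fubini's theorem applicable; by the Fourier transform of a Gaussian the
  regularised integral is a Gaussian average of the autocorrelation of \<open>h\<close>.
\<close>

lemma fourier_gauss: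
  fixes h :: "real^'d::finite \<Rightarrow> complex"
  assumes h: "square_integrable h" and h1: "integrable lborel h" and r: "0 < r"
  shows "complex_of_real (\<integral>\<omega>. gauss ((2 * pi / r) *\<^sub>R \<omega>) * (cmod (fourier h \<omega>))\<^sup>2 \<partial>lborel)
    = (\<integral>w. of_real (gauss w) * cinner (abs_L2 h) (time_freq_shift ((1 / r) *\<^sub>R w, 0) (abs_L2 h)) \<partial>lborel)
      / of_real (sqrt (2 * pi) ^ CARD('d))"
proof -
  have [measurable]: "h \<in> borel_measurable borel"
    using h1 by simp
  define c where "c = sqrt (2 * pi) ^ CARD('d)"
  define E where "E \<omega> t = exp (2 * pi * \<i> * complex_of_real (\<omega> \<bullet> t))" for \<omega> t :: "real^'d"
  have [measurable]: "(\<lambda>x. E (f x) (g x)) \<in> borel_measurable M"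
    if [measurable]: "f \<in> borel_measurable M" "g \<in> borel_measurable M" for f g and M :: "'z measure"
    unfolding E_def by measurable
  have E_norm: "cmod (E \<omega> t) = 1" for \<omega> t by (simp add: E_def)
  have E_diff: "E \<omega> (t - s) = E \<omega> t * cnj (E \<omega> s)" for \<omega> t s
    unfolding E_def exp_cnj exp_add[symmetric]
    by (rule arg_cong[where f=exp]) (simp add: inner_diff_right algebra_simps)
  define G where "G \<omega> = gauss ((2 * pi / r) *\<^sub>R \<omega>)" for \<omega> :: "real^'d"
  have [measurable]: "G \<in> borel_measurable borel" unfolding G_def by measurable
  have G_int: "integrable lborel (\<lambda>\<omega>. complex_of_real (G \<omega>))"
    using integrable_lborel_affine[OF integrable_gauss, of "2 * pi / r" "0 :: real^'d"] r
    by (simp add: G_def)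
  define A where "A y = cinner (abs_L2 h) (time_freq_shift (y, 0) (abs_L2 h))" for y
  have A: "A y = (\<integral>t. h t * cnj (h (t - y)) \<partial>lborel)" for y
  proof -
    have s: "square_integrable (\<lambda>t. h (t - y))"
      "time_freq_shift (y, 0) (abs_L2 h) = abs_L2 (\<lambda>t. h (t - y))"
      using time_freq_shift_abs[OF h, where x=y and \<omega>=0] by simp_all
    show ?thesis unfolding A_def s(2) by (rule L2_cinner_abs[OF h s(1)])
  qed
  have [measurable]: "A \<in> borel_measurable borel" unfolding A by measurable
  \<comment> \<open>The transform of the dilated Gaussian: again a Gaussian, bounded by the constant
    \<open>k\<close> below. This bound justifies the later uses of Fubini.\<close>
  define K where "K y = (\<integral>\<omega>. of_real (G \<omega>) * E \<omega> y \<partial>lborel)" for y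
  have K: "K y = of_real ((r / (2 * pi)) ^ CARD('d) * c * gauss (r *\<^sub>R y))" for y
  proof -
    let ?f = "\<lambda>w. of_real (gauss w) * exp (\<i> * complex_of_real (w \<bullet> (r *\<^sub>R y)))"
    have "?f ((2 * pi / r) *\<^sub>R \<omega>) = of_real (G \<omega>) * E \<omega> y" for \<omega>
      using r by (simp add: G_def E_def mult_ac)
    moreover have "(\<integral>w. ?f w \<partial>lborel) = \<bar>2 * pi / r\<bar> ^ DIM(real^'d) *\<^sub>R (\<integral>\<omega>. ?f (0 + (2 * pi / r) *\<^sub>R \<omega>) \<partial>lborel)"
      by (rule integral_lborel_affine) (use r in auto)
    ultimately have "(\<integral>w. ?f w \<partial>lborel) = of_real ((2 * pi / r) ^ CARD('d)) * K y"
      using r by (simp add: K_def scaleR_conv_of_real)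
    then have "of_real ((2 * pi / r) ^ CARD('d)) * K y = of_real (c * gauss (r *\<^sub>R y))"
      using gauss_fourier(2)[of "r *\<^sub>R y"] by (simp add: c_def)
    then show ?thesis
      using r by (simp add: field_simps)
  qed
  have [measurable]: "K \<in> borel_measurable borel" unfolding K by measurable
  define k where "k = (r / (2 * pi)) ^ CARD('d) * c"
  have k0: "0 \<le> k" using r by (simp add: k_def c_def)
  have K_le: "cmod (K y) \<le> k" for y
    using mult_left_mono[OF gauss_bounds(2)[of "r *\<^sub>R y"] k0] k0 less_imp_le[OF gauss_bounds(1)[of "r *\<^sub>R y"]]
    unfolding K k_def[symmetric] norm_of_real by (simp add: abs_mult)
  let ?H = "\<lambda>p. h (fst p) * cnj (h (snd p))"
  have hc: "integrable lborel (\<lambda>t. cnj (h t))" using h1 by simp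
  have H_int: "integrable lborel ?H"
    using integrable_mult_pair[OF h1 hc] by (simp add: lborel_prod case_prod_unfold)
  \<comment> \<open>As a double integral the squared modulus involves \<open>\<omega>\<close> only
    through the difference of the two points, so integrating out \<open>\<omega>\<close> produces
    \<open>K\<close> at that difference.\<close>
  have sq: "complex_of_real ((cmod (fourier h \<omega>))\<^sup>2) = (\<integral>p. E \<omega> (fst p - snd p) * ?H p \<partial>lborel)" for \<omega>
  proof -
    have f: "integrable lborel (\<lambda>t. E \<omega> t * h t)"
      by (rule Bochner_Integration.integrable_bound[OF h1]) (simp_all add: norm_mult E_norm)
    have "fourier h \<omega> * cnj (fourier h \<omega>)
        = (\<integral>t. E \<omega> t * h t \<partial>lborel) * (\<integral>s. cnj (E \<omega> s * h s) \<partial>lborel)"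
      by (simp only: fourier_def E_def Bochner_Integration.integral_cnj)
    also have "\<dots> = (\<integral>p. (E \<omega> (fst p) * h (fst p)) * cnj (E \<omega> (snd p) * h (snd p)) \<partial>lborel)"
      by (rule integral_mult_pair[symmetric, OF f]) (use f in \<open>simp del: complex_cnj_mult\<close>)
    also have "\<dots> = (\<integral>p. E \<omega> (fst p - snd p) * ?H p \<partial>lborel)"
      by (simp add: E_diff mult_ac)
    finally show ?thesis by (simp only: complex_norm_square)
  qed
  have "complex_of_real (\<integral>\<omega>. G \<omega> * (cmod (fourier h \<omega>))\<^sup>2 \<partial>lborel)
      = (\<integral>\<omega>. (\<integral>p. of_real (G \<omega>) * (E \<omega> (fst p - snd p) * ?H p) \<partial>lborel) \<partial>lborel)"
    unfolding integral_complex_of_real[symmetric] of_real_mult sq by simp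
  also have "\<dots> = (\<integral>p. (\<integral>\<omega>. of_real (G \<omega>) * (E \<omega> (fst p - snd p) * ?H p) \<partial>lborel) \<partial>lborel)"
  proof (rule lborel_pair.Fubini_integral[symmetric])
    show "integrable (lborel \<Otimes>\<^sub>M lborel) (\<lambda>(\<omega>, p). of_real (G \<omega>) * (E \<omega> (fst p - snd p) * ?H p))"
    proof (rule Bochner_Integration.integrable_bound[OF integrable_mult_pair[OF G_int H_int]])
      show "AE x in lborel \<Otimes>\<^sub>M lborel. norm (case x of (\<omega>, p) \<Rightarrow> of_real (G \<omega>) * (E \<omega> (fst p - snd p) * ?H p))
          \<le> norm (case x of (\<omega>, p) \<Rightarrow> of_real (G \<omega>) * ?H p)"
        by (intro AE_I2) (auto simp: norm_mult E_norm)
      show "(\<lambda>(\<omega>, p). of_real (G \<omega>) * (E \<omega> (fst p - snd p) * ?H p)) \<in> borel_measurable (lborel \<Otimes>\<^sub>M lborel)"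
        unfolding lborel_prod[symmetric] case_prod_unfold by measurable
    qed
  qed
  also have "\<dots> = (\<integral>p. ?H p * K (fst p - snd p) \<partial>lborel)"
    unfolding K_def by (simp add: mult_ac flip: integral_mult_right_zero)
  also have "\<dots> = (\<integral>t. (\<integral>s. h t * cnj (h s) * K (t - s) \<partial>lborel) \<partial>lborel)"
  proof -
    have "integrable lborel (\<lambda>p. ?H p * K (fst p - snd p))"
    proof (rule Bochner_Integration.integrable_bound)
      show "integrable lborel (\<lambda>p. of_real k * ?H p)" by (intro integrable_mult_right H_int)
      show "AE p in lborel. norm (?H p * K (fst p - snd p)) \<le> norm (of_real k * ?H p)"
      proof (rule AE_I2)
        fix p
        show "norm (?H p * K (fst p - snd p)) \<le> norm (of_real k * ?H p)"
          using mult_left_mono[OF K_le[of "fst p - snd p"], of "cmod (?H p)"] k0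
          by (simp add: norm_mult mult_ac)
      qed
      show "(\<lambda>p. ?H p * K (fst p - snd p)) \<in> borel_measurable lborel"
        unfolding lborel_prod[symmetric] by measurable
    qed
    from lborel_pair.integral_fst'[OF this[folded lborel_prod]] show ?thesis
      by (simp add: lborel_prod)
  qed
  also have "\<dots> = (\<integral>t. (\<integral>y. h t * cnj (h (t - y)) * K y \<partial>lborel) \<partial>lborel)"
  proof (rule Bochner_Integration.integral_cong[OF refl])
    fix t
    show "(\<integral>s. h t * cnj (h s) * K (t - s) \<partial>lborel) = (\<integral>y. h t * cnj (h (t - y)) * K y \<partial>lborel)"
      using integral_lborel_affine[of "\<lambda>s. h t * cnj (h s) * K (t - s)" "-1" t] by simp
  qed
  \<comment> \<open>With the difference \<open>y\<close> as outer variable, the inner integral is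
    the autocorrelation \<open>A y\<close> times \<open>K y\<close>.\<close>
  also have "\<dots> = (\<integral>y. (\<integral>t. h t * cnj (h (t - y)) * K y \<partial>lborel) \<partial>lborel)"
  proof (rule lborel_pair.Fubini_integral[symmetric], rule lborel_pair.Fubini_integrable)
    have shift: "integrable lborel (\<lambda>y. h (t - y))" "(\<integral>y. cmod (h (t - y)) \<partial>lborel) = (\<integral>y. cmod (h y) \<partial>lborel)" for t
      using integrable_lborel_affine[OF h1, of "-1" t] integral_lborel_affine[of "\<lambda>y. cmod (h y)" "-1" t]
      by simp_all
    have kint: "integrable lborel (\<lambda>y. h t * cnj (h (t - y)) * K y)" for t
    proof (rule Bochner_Integration.integrable_bound)
      show "integrable lborel (\<lambda>y. (of_real k * h t) * h (t - y))"
        by (intro integrable_mult_right shift)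
      show "AE y in lborel. norm (h t * cnj (h (t - y)) * K y) \<le> norm ((of_real k * h t) * h (t - y))"
      proof (rule AE_I2)
        fix y
        show "norm (h t * cnj (h (t - y)) * K y) \<le> norm ((of_real k * h t) * h (t - y))"
          using mult_left_mono[OF K_le[of y], of "cmod (h t) * cmod (h (t - y))"] k0
          by (simp add: norm_mult mult_ac)
      qed
    qed simp
    show "integrable lborel (\<lambda>t. \<integral>y. norm (case (t, y) of (t, y) \<Rightarrow> h t * cnj (h (t - y)) * K y) \<partial>lborel)"
    proof (rule Bochner_Integration.integrable_bound)
      show "integrable lborel (\<lambda>t. (k * (\<integral>y. cmod (h y) \<partial>lborel)) *\<^sub>R h t)"
        by (intro integrable_scaleR_right h1)
      show "AE t in lborel. norm (\<integral>y. norm (case (t, y) of (t, y) \<Rightarrow> h t * cnj (h (t - y)) * K y) \<partial>lborel)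
          \<le> norm ((k * (\<integral>y. cmod (h y) \<partial>lborel)) *\<^sub>R h t)"
      proof (rule AE_I2)
        fix t
        have "(\<integral>y. norm (h t * cnj (h (t - y)) * K y) \<partial>lborel) \<le> (\<integral>y. (k * cmod (h t)) * cmod (h (t - y)) \<partial>lborel)"
        proof (rule integral_mono)
          show "integrable lborel (\<lambda>y. (k * cmod (h t)) * cmod (h (t - y)))"
            using shift(1) by (intro integrable_mult_right integrable_norm)
          show "norm (h t * cnj (h (t - y)) * K y) \<le> (k * cmod (h t)) * cmod (h (t - y))" for y
            using mult_left_mono[OF K_le[of y], of "cmod (h t) * cmod (h (t - y))"]
            by (simp add: norm_mult mult_ac)
        qed (rule integrable_norm[OF kint])
        then show "norm (\<integral>y. norm (case (t, y) of (t, y) \<Rightarrow> h t * cnj (h (t - y)) * K y) \<partial>lborel)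
          \<le> norm ((k * (\<integral>y. cmod (h y) \<partial>lborel)) *\<^sub>R h t)"
          using k0 by (simp add: shift(2) mult_ac)
      qed
    qed measurable
    show "AE t in lborel. integrable lborel (\<lambda>y. case (t, y) of (t, y) \<Rightarrow> h t * cnj (h (t - y)) * K y)"
      using kint by simp
  qed measurable
  also have "\<dots> = (\<integral>y. A y * K y \<partial>lborel)"
    by (simp add: A)
  also have "\<dots> = (\<integral>y. of_real k * (of_real (gauss (r *\<^sub>R y)) * A y) \<partial>lborel)"
    unfolding K k_def by (simp only: of_real_mult mult_ac)
  also have "\<dots> = of_real k * (\<integral>y. of_real (gauss (r *\<^sub>R y)) * A y \<partial>lborel)"
    by simp
  also have "(\<integral>y. of_real (gauss (r *\<^sub>R y)) * A y \<partial>lborel)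
      = (\<integral>w. of_real (gauss w) * A ((1 / r) *\<^sub>R w) \<partial>lborel) / of_real (r ^ CARD('d))"
  proof -
    have "(\<integral>w. of_real (gauss w) * A ((1 / r) *\<^sub>R w) \<partial>lborel)
      = \<bar>r\<bar> ^ DIM(real^'d) *\<^sub>R (\<integral>y. of_real (gauss (0 + r *\<^sub>R y)) * A ((1 / r) *\<^sub>R (0 + r *\<^sub>R y)) \<partial>lborel)"
      by (rule integral_lborel_affine) (use r in auto)
    then show ?thesis using r by (simp add: scaleR_conv_of_real[where 'a=complex])
  qed
  \<comment> \<open>\<open>c\<close> squared is \<open>(2 * pi) ^ CARD('d)\<close>, so the constants
    from dilation and from the Gaussian collapse to \<open>1 / c\<close>.\<close>
  also have "of_real k * \<dots> = (\<integral>w. of_real (gauss w) * A ((1 / r) *\<^sub>R w) \<partial>lborel) / of_real c"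
  proof -
    have cc: "c * c = (2 * pi) ^ CARD('d)"
      unfolding c_def power_mult_distrib[symmetric] by simp
    have "k / r ^ CARD('d) = c / (2 * pi) ^ CARD('d)"
      using r by (simp add: k_def power_divide)
    also have "\<dots> = 1 / c"
      unfolding cc[symmetric] by (simp add: c_def)
    finally have "complex_of_real k / of_real (r ^ CARD('d)) = 1 / of_real c"
      by (metis of_real_1 of_real_divide)
    moreover have "of_real k * (I / of_real (r ^ CARD('d))) = (of_real k / of_real (r ^ CARD('d))) * I" for I :: complex
      by simp
    ultimately show ?thesis by simp
  qed
  finally show ?thesis unfolding G_def A_def c_def .
qed

text \<open>Let \<open>r\<close> tend to infinity in \<open>fourier_gauss\<close>. On the right,
  continuity of translations gives the squared norm of \<open>h\<close>; on the left the Gaussian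
  factor increases to 1, so monotone convergence yields integrability and value together.\<close>

lemma plancherel:
  fixes h :: "real^'d::finite \<Rightarrow> complex"
  assumes h: "square_integrable h" and h1: "integrable lborel h"
  shows "integrable lborel (\<lambda>\<omega>. (cmod (fourier h \<omega>))\<^sup>2)"
    and "(\<integral>\<omega>. (cmod (fourier h \<omega>))\<^sup>2 \<partial>lborel) = (\<integral>t. (cmod (h t))\<^sup>2 \<partial>lborel)"
proof -
  have [measurable]: "h \<in> borel_measurable borel" using h1 by simp
  define c where "c = sqrt (2 * pi) ^ CARD('d)"
  have "0 < c" by (simp add: c_def)
  define H where "H = abs_L2 h"
  define r where "r n = real (Suc n)" for n
  have r: "0 < r n" for n by (simp add: r_def)
  define g where "g n \<omega> = gauss ((2 * pi / r n) *\<^sub>R \<omega>) * (cmod (fourier h \<omega>))\<^sup>2" for n \<omega>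
  have bound: "cmod (fourier h \<omega>) \<le> (\<integral>t. cmod (h t) \<partial>lborel)" for \<omega>
    unfolding fourier_def
    by (rule order_trans[OF integral_norm_bound]) (simp add: norm_mult)
  have g_int: "integrable lborel (g n)" for n
  proof (rule Bochner_Integration.integrable_bound)
    show "integrable lborel (\<lambda>\<omega>. gauss (0 + (2 * pi / r n) *\<^sub>R \<omega>) * (\<integral>t. cmod (h t) \<partial>lborel)\<^sup>2)"
      using r[of n] by (intro integrable_mult_left integrable_lborel_affine integrable_gauss) auto
    show "AE \<omega> in lborel. norm (g n \<omega>) \<le> norm (gauss (0 + (2 * pi / r n) *\<^sub>R \<omega>) * (\<integral>t. cmod (h t) \<partial>lborel)\<^sup>2)"
      using power_mono[OF bound, of _ 2] less_imp_le[OF gauss_bounds(1)]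
      by (intro AE_I2) (simp add: g_def abs_mult mult_left_mono)
  qed (simp add: g_def[abs_def])
  have r_lim: "(\<lambda>n. 1 / r n) \<longlonglongrightarrow> 0"
    unfolding r_def using LIMSEQ_inverse_real_of_nat by (simp add: inverse_eq_divide)
  let ?A = "\<lambda>n w. cinner H (time_freq_shift ((1 / r n) *\<^sub>R w, 0) H)"
  \<comment> \<open>The integral form makes measurability in the shift visible.\<close>
  have A_eq: "cinner H (time_freq_shift (y, 0) H) = (\<integral>t. h t * cnj (h (t - y)) \<partial>lborel)" for y
  proof -
    have s: "square_integrable (\<lambda>t. h (t - y))"
      "time_freq_shift (y, 0) H = abs_L2 (\<lambda>t. h (t - y))"
      using time_freq_shift_abs[OF h, where x=y and \<omega>=0] by (simp_all add: H_def)
    show ?thesis unfolding s(2) by (simp add: H_def L2_cinner_abs h s(1))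
  qed
  have "(\<lambda>n. \<integral>w. of_real (gauss w) * ?A n w \<partial>lborel)
      \<longlonglongrightarrow> (\<integral>w. complex_of_real (gauss (w::real^'d)) * cinner H H \<partial>lborel)"
  proof (rule integral_dominated_convergence[where w="\<lambda>w. gauss w * (norm H)\<^sup>2"])
    show "integrable lborel (\<lambda>w::real^'d. gauss w * (norm H)\<^sup>2)"
      by (intro integrable_mult_left integrable_gauss)
    show "AE w in lborel. (\<lambda>n. of_real (gauss w) * ?A n w) \<longlonglongrightarrow> of_real (gauss w) * cinner H H"
    proof (rule AE_I2)
      fix w :: "real^'d"
      have "(\<lambda>n. (1 / r n) *\<^sub>R w) \<longlonglongrightarrow> 0 *\<^sub>R w" by (intro tendsto_intros r_lim)
      then have "(\<lambda>n. time_freq_shift ((1 / r n) *\<^sub>R w, 0) H) \<longlonglongrightarrow> H"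
        by (intro translation_continuous) simp
      then show "(\<lambda>n. of_real (gauss w) * ?A n w) \<longlonglongrightarrow> of_real (gauss w) * cinner H H"
        by (intro tendsto_mult tendsto_const cinner.tendsto)
    qed
    fix n
    show "AE w in lborel. norm (of_real (gauss w) * ?A n w) \<le> gauss w * (norm H)\<^sup>2"
    proof (rule AE_I2)
      fix w :: "real^'d"
      show "norm (of_real (gauss w) * ?A n w) \<le> gauss w * (norm H)\<^sup>2"
        using mult_left_mono[OF cmod_cinner_le[of H "time_freq_shift ((1 / r n) *\<^sub>R w, 0) H"] less_imp_le[OF gauss_bounds(1)[of w]]]
          less_imp_le[OF gauss_bounds(1)[of w]]
        by (simp add: norm_mult power2_eq_square)
    qed
    show "(\<lambda>w. of_real (gauss w) * ?A n w) \<in> borel_measurable lborel"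
      unfolding A_eq by measurable
  qed measurable
  moreover have "(\<integral>w. complex_of_real (gauss (w::real^'d)) * cinner H H \<partial>lborel) = of_real c * of_real ((norm H)\<^sup>2)"
    by (simp add: cinner_self integral_complex_of_real integral_gauss c_def del: of_real_power)
  moreover have "(\<integral>w. of_real (gauss w) * ?A n w \<partial>lborel) = of_real c * complex_of_real (\<integral>\<omega>. g n \<omega> \<partial>lborel)" for n
    using fourier_gauss[OF h h1 r[of n]] \<open>0 < c\<close>
    by (simp add: g_def H_def c_def del: of_real_power)
  ultimately have "(\<lambda>n. of_real c * complex_of_real (\<integral>\<omega>. g n \<omega> \<partial>lborel)) \<longlonglongrightarrow> of_real c * of_real ((norm H)\<^sup>2)"
    by simp
  then have "(\<lambda>n. c * (\<integral>\<omega>. g n \<omega> \<partial>lborel)) \<longlonglongrightarrow> c * (norm H)\<^sup>2"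
    unfolding of_real_mult[symmetric] tendsto_of_real_iff .
  then have lim: "(\<lambda>n. \<integral>\<omega>. g n \<omega> \<partial>lborel) \<longlonglongrightarrow> (norm H)\<^sup>2"
    using \<open>0 < c\<close> by (simp add: tendsto_mult_left_iff)
  have mono: "AE \<omega> in lborel. mono (\<lambda>n. g n \<omega>)"
  proof (rule AE_I2, rule monoI)
    fix \<omega> :: "real^'d" and m n :: nat assume "m \<le> n"
    then have le: "2 * pi / r n \<le> 2 * pi / r m" by (simp add: r_def frac_le)
    have "norm ((2 * pi / r n) *\<^sub>R \<omega>) \<le> norm ((2 * pi / r m) *\<^sub>R \<omega>)"
      using mult_right_mono[OF le norm_ge_zero[of \<omega>]] r[of n] r[of m] by simp
    then have "(norm ((2 * pi / r n) *\<^sub>R \<omega>))\<^sup>2 \<le> (norm ((2 * pi / r m) *\<^sub>R \<omega>))\<^sup>2"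
      by (rule power_mono) simp
    then have "gauss ((2 * pi / r m) *\<^sub>R \<omega>) \<le> gauss ((2 * pi / r n) *\<^sub>R \<omega>)"
      unfolding gauss_def by simp
    then show "g m \<omega> \<le> g n \<omega>" unfolding g_def by (rule mult_right_mono) simp
  qed
  have ptw: "AE \<omega> in lborel. (\<lambda>n. g n \<omega>) \<longlonglongrightarrow> (cmod (fourier h \<omega>))\<^sup>2"
  proof (rule AE_I2)
    fix \<omega> :: "real^'d"
    have "(\<lambda>n. gauss ((2 * pi * (1 / r n)) *\<^sub>R \<omega>) * (cmod (fourier h \<omega>))\<^sup>2)
        \<longlonglongrightarrow> exp (- (norm ((2 * pi * 0) *\<^sub>R \<omega>))\<^sup>2 / 2) * (cmod (fourier h \<omega>))\<^sup>2"
      unfolding gauss_def by (intro tendsto_intros r_lim) simp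
    then show "(\<lambda>n. g n \<omega>) \<longlonglongrightarrow> (cmod (fourier h \<omega>))\<^sup>2"
      by (simp add: g_def)
  qed
  have meas: "(\<lambda>\<omega>. (cmod (fourier h \<omega>))\<^sup>2) \<in> borel_measurable lborel" by simp
  show "integrable lborel (\<lambda>\<omega>. (cmod (fourier h \<omega>))\<^sup>2)"
    by (rule integrable_monotone_convergence[OF g_int mono ptw lim meas])
  show "(\<integral>\<omega>. (cmod (fourier h \<omega>))\<^sup>2 \<partial>lborel) = (\<integral>t. (cmod (h t))\<^sup>2 \<partial>lborel)"
    using integral_monotone_convergence[OF g_int mono ptw lim meas] norm_L2_abs[OF h]
    by (simp add: H_def)
qed

subsection \<open>Moyal's identity\<close>

lemma measurable_matrix_coefficient:
  fixes U P :: "'d::finite L2"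
  shows "(\<lambda>z. cinner (time_freq_shift z U) P) \<in> borel_measurable lborel"
proof -
  obtain u where u: "square_integrable u" "U = abs_L2 u" by (rule L2_cases)
  obtain p where p: "square_integrable p" "P = abs_L2 p" by (rule L2_cases)
  have [measurable]: "u \<in> borel_measurable borel" "p \<in> borel_measurable borel"
    using u p by (simp_all add: square_integrable_def)
  have "cinner (time_freq_shift z U) P = (\<integral>t. (exp (2 * pi * \<i> * complex_of_real (snd z \<bullet> t)) * u (t - fst z)) * cnj (p t) \<partial>lborel)" for z
    unfolding u(2) p(2) time_freq_shift_abs(1)[OF u(1), of "fst z" "snd z", unfolded prod.collapse]
    by (rule L2_cinner_abs[OF time_freq_shift_abs(2)[OF u(1)] p(1)])
  then show ?thesis
    unfolding lborel_prod[symmetric] by simp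
qed

text \<open>For fixed \<open>x\<close> the coefficient is a Fourier transform in
  \<open>\<omega>\<close>. Plancherel removes \<open>\<omega>\<close>, and the remaining integral
  over \<open>x\<close> and \<open>t\<close> factors because Lebesgue measure is invariant under
  \<open>x \<mapsto> t - x\<close>.\<close>

lemma moyal_norm:
  fixes U P :: "'d::finite L2"
  shows "integrable lborel (\<lambda>z. (cmod (cinner (time_freq_shift z U) P))\<^sup>2)"
    and "(\<integral>z. (cmod (cinner (time_freq_shift z U) P))\<^sup>2 \<partial>lborel) = (norm U)\<^sup>2 * (norm P)\<^sup>2"
proof -
  obtain u where u: "square_integrable u" "U = abs_L2 u" by (rule L2_cases)
  obtain p where p: "square_integrable p" "P = abs_L2 p" by (rule L2_cases)
  have [measurable]: "u \<in> borel_measurable borel" "p \<in> borel_measurable borel"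
    using u p by (simp_all add: square_integrable_def)
  define V where "V z = (cmod (cinner (time_freq_shift z U) P))\<^sup>2" for z
  have V_meas: "V \<in> borel_measurable lborel"
    unfolding V_def using measurable_matrix_coefficient[of U P] by measurable
  define h where "h x t = u (t - x) * cnj (p t)" for x t
  have shift: "square_integrable (\<lambda>t. u (t - x))" for x
    using time_freq_shift_abs(2)[OF u(1), where x=x and \<omega>=0] by simp
  have h1: "integrable lborel (h x)" for x
    unfolding h_def by (rule square_integrable_mult_cnj[OF shift p(1)])
  have V: "V (x, \<omega>) = (cmod (fourier (h x) \<omega>))\<^sup>2" for x \<omega>
    unfolding V_def u(2) p(2) time_freq_shift_abs(1)[OF u(1)]
      L2_cinner_abs[OF time_freq_shift_abs(2)[OF u(1)] p(1)] fourier_def h_def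
    by (simp only: mult.assoc)
  let ?F = "\<lambda>t x. (cmod (u (t - x)))\<^sup>2 * (cmod (p t))\<^sup>2"
  have uI: "integrable lborel (\<lambda>t. (cmod (u t))\<^sup>2)" and pI: "integrable lborel (\<lambda>t. (cmod (p t))\<^sup>2)"
    using u p by (simp_all add: square_integrable_def)
  have u_refl: "integrable lborel (\<lambda>x. (cmod (u (t - x)))\<^sup>2)"
    "(\<integral>x. (cmod (u (t - x)))\<^sup>2 \<partial>lborel) = (norm U)\<^sup>2" for t
    using integrable_lborel_affine[OF uI, of "-1" t] integral_lborel_affine[of "\<lambda>x. (cmod (u x))\<^sup>2" "-1" t]
    by (simp_all add: u(2) norm_L2_abs[OF u(1)])
  have F: "integrable (lborel \<Otimes>\<^sub>M lborel) (\<lambda>(t, x). ?F t x)"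
  proof (rule lborel_pair.Fubini_integrable)
    show "integrable lborel (\<lambda>t. \<integral>x. norm (case (t, x) of (t, x) \<Rightarrow> ?F t x) \<partial>lborel)"
      using pI by (simp add: u_refl)
    show "AE t in lborel. integrable lborel (\<lambda>x. case (t, x) of (t, x) \<Rightarrow> ?F t x)"
      using u_refl by simp
  qed measurable
  have F': "integrable (lborel \<Otimes>\<^sub>M lborel) (\<lambda>(x, t). ?F t x)"
    using lborel_pair.integrable_product_swap[OF F] by (simp add: case_prod_unfold)
  \<comment> \<open>\<open>h x\<close> is integrable for every \<open>x\<close>, but its square
    integrability comes from Fubini and holds only almost everywhere.\<close>
  have h2: "AE x in lborel. square_integrable (h x)"
    using lborel_pair.AE_integrable_fst'[OF F']
  proof eventually_elim
    case (elim x)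
    then show ?case
      using h1[of x] by (simp add: square_integrable_def h_def norm_mult power_mult_distrib)
  qed
  have inner: "AE x in lborel. integrable lborel (\<lambda>\<omega>. V (x, \<omega>))
      \<and> (\<integral>\<omega>. V (x, \<omega>) \<partial>lborel) = (\<integral>t. ?F t x \<partial>lborel)"
    using h2
  proof eventually_elim
    case (elim x)
    show ?case
      unfolding V using plancherel[OF elim h1]
      by (simp add: h_def norm_mult power_mult_distrib)
  qed
  have V_meas': "V \<in> borel_measurable (lborel \<Otimes>\<^sub>M lborel)"
    using V_meas by (simp add: lborel_prod)
  have [measurable]: "V \<in> borel_measurable (borel \<Otimes>\<^sub>M borel)"
    using V_meas by (simp add: borel_prod)
  have V_int: "integrable (lborel \<Otimes>\<^sub>M lborel) V"
  proof (rule lborel_pair.Fubini_integrable[OF V_meas'])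
    have "integrable lborel (\<lambda>x. \<integral>t. ?F t x \<partial>lborel)"
      using lborel_pair.integrable_fst'[OF F'] by simp
    moreover have "AE x in lborel. (\<integral>t. ?F t x \<partial>lborel) = (\<integral>\<omega>. norm (V (x, \<omega>)) \<partial>lborel)"
      using inner by eventually_elim (simp add: V_def)
    ultimately show "integrable lborel (\<lambda>x. \<integral>\<omega>. norm (V (x, \<omega>)) \<partial>lborel)"
      by (subst (asm) integrable_cong_AE) auto
    show "AE x in lborel. integrable lborel (\<lambda>\<omega>. V (x, \<omega>))"
      using inner by eventually_elim simp
  qed
  then show "integrable lborel (\<lambda>z. (cmod (cinner (time_freq_shift z U) P))\<^sup>2)"
    by (simp add: lborel_prod flip: V_def)
  have "(\<integral>z. V z \<partial>lborel) = (\<integral>x. \<integral>\<omega>. V (x, \<omega>) \<partial>lborel \<partial>lborel)"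
    using lborel_pair.integral_fst'[OF V_int] by (simp add: lborel_prod)
  also have "\<dots> = (\<integral>x. \<integral>t. ?F t x \<partial>lborel \<partial>lborel)"
    using inner by (intro integral_cong_AE) (auto elim: eventually_mono)
  also have "\<dots> = (\<integral>t. \<integral>x. ?F t x \<partial>lborel \<partial>lborel)"
    by (rule lborel_pair.Fubini_integral[OF F])
  also have "\<dots> = (norm U)\<^sup>2 * (norm P)\<^sup>2"
    by (simp add: u_refl p(2) norm_L2_abs[OF p(1)])
  finally show "(\<integral>z. (cmod (cinner (time_freq_shift z U) P))\<^sup>2 \<partial>lborel) = (norm U)\<^sup>2 * (norm P)\<^sup>2"
    by (simp add: V_def)
qed

lemma polarization: "4 * (a * cnj b) = of_real ((cmod (a + b))\<^sup>2) - of_real ((cmod (a - b))\<^sup>2)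
    + \<i> * of_real ((cmod (a + \<i> * b))\<^sup>2) - \<i> * of_real ((cmod (a - \<i> * b))\<^sup>2)"
  unfolding complex_norm_square by (simp add: algebra_simps)

lemma polarization_L2: "4 * cinner f g = of_real ((norm (f + g))\<^sup>2) - of_real ((norm (f - g))\<^sup>2)
    + \<i> * of_real ((norm (f + cscale \<i> g))\<^sup>2) - \<i> * of_real ((norm (f - cscale \<i> g))\<^sup>2)"
  unfolding cinner_self[symmetric]
  by (simp add: cinner.add_left cinner.add_right cinner.diff_left cinner.diff_right
      cinner_cscale_left cinner_cscale_right algebra_simps)

lemma integrable_mult_cnj_square:
  fixes f g :: "'a \<Rightarrow> complex"
  assumes [measurable]: "f \<in> borel_measurable M" "g \<in> borel_measurable M"
    and "integrable M (\<lambda>z. (cmod (f z))\<^sup>2)" "integrable M (\<lambda>z. (cmod (g z))\<^sup>2)"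
  shows "integrable M (\<lambda>z. f z * cnj (g z))"
    and "(\<integral>z. cmod (f z * cnj (g z)) \<partial>M) \<le> ((\<integral>z. (cmod (f z))\<^sup>2 \<partial>M) + (\<integral>z. (cmod (g z))\<^sup>2 \<partial>M)) / 2"
proof -
  have le: "cmod (f z * cnj (g z)) \<le> ((cmod (f z))\<^sup>2 + (cmod (g z))\<^sup>2) / 2" for z
    using sum_squares_bound[of "cmod (f z)" "cmod (g z)"] by (simp add: norm_mult)
  have int: "integrable M (\<lambda>z. ((cmod (f z))\<^sup>2 + (cmod (g z))\<^sup>2) / 2)"
    using assms(3,4) by simp
  show i: "integrable M (\<lambda>z. f z * cnj (g z))"
    by (rule Bochner_Integration.integrable_bound[OF int])
      (use le in \<open>auto intro!: AE_I2 order_trans[OF le]\<close>)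
  have "(\<integral>z. cmod (f z * cnj (g z)) \<partial>M) \<le> (\<integral>z. ((cmod (f z))\<^sup>2 + (cmod (g z))\<^sup>2) / 2 \<partial>M)"
    by (rule integral_mono[OF integrable_norm[OF i] int le])
  then show "(\<integral>z. cmod (f z * cnj (g z)) \<partial>M) \<le> ((\<integral>z. (cmod (f z))\<^sup>2 \<partial>M) + (\<integral>z. (cmod (g z))\<^sup>2 \<partial>M)) / 2"
    using assms(3,4) by simp
qed

text \<open>Two polarizations of \<open>moyal_norm\<close>: first in \<open>U\<close> and
  \<open>V\<close> with equal second vectors, then in the second vectors.\<close>

lemma moyal:
  fixes U V P Q :: "'d::finite L2"
  shows "integrable lborel (\<lambda>z. cinner (time_freq_shift z U) P * cnj (cinner (time_freq_shift z V) Q))"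
    and "(\<integral>z. cmod (cinner (time_freq_shift z U) P * cnj (cinner (time_freq_shift z V) Q)) \<partial>lborel)
      \<le> ((norm U)\<^sup>2 * (norm P)\<^sup>2 + (norm V)\<^sup>2 * (norm Q)\<^sup>2) / 2"
    and "(\<integral>z. cinner (time_freq_shift z U) P * cnj (cinner (time_freq_shift z V) Q) \<partial>lborel)
      = cinner U V * cinner Q P"
proof -
  let ?c = "\<lambda>U P z. cinner (time_freq_shift z U) P"
  note I = integrable_mult_cnj_square[OF measurable_matrix_coefficient measurable_matrix_coefficient
      moyal_norm(1) moyal_norm(1)]
  show int: "integrable lborel (\<lambda>z. ?c U P z * cnj (?c V Q z))" for U P V Q :: "'d L2"
    by (rule I(1))
  show "(\<integral>z. cmod (?c U P z * cnj (?c V Q z)) \<partial>lborel)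
      \<le> ((norm U)\<^sup>2 * (norm P)\<^sup>2 + (norm V)\<^sup>2 * (norm Q)\<^sup>2) / 2"
    using I(2)[of U P V Q] unfolding moyal_norm(2) .
  note lin = bounded_operatorD[OF bounded_operator_time_freq_shift]
  have sq: "(\<integral>z. complex_of_real ((cmod (?c U P z))\<^sup>2) \<partial>lborel) = of_real ((norm U)\<^sup>2 * (norm P)\<^sup>2)"
    "integrable lborel (\<lambda>z. complex_of_real ((cmod (?c U P z))\<^sup>2))" for U P :: "'d L2"
    using moyal_norm[of U P] by (simp_all only: integral_complex_of_real integrable_of_real)
  have diag: "(\<integral>z. ?c U P z * cnj (?c V P z) \<partial>lborel) = cinner U V * of_real ((norm P)\<^sup>2)" for U V P :: "'d L2"
  proof -
    have "4 * (?c U P z * cnj (?c V P z)) = of_real ((cmod (?c (U + V) P z))\<^sup>2) - of_real ((cmod (?c (U - V) P z))\<^sup>2)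
      + \<i> * of_real ((cmod (?c (U + cscale \<i> V) P z))\<^sup>2) - \<i> * of_real ((cmod (?c (U - cscale \<i> V) P z))\<^sup>2)" for z
      unfolding polarization lin cinner.add_left cinner.diff_left cinner_cscale_left ..
    then have "(\<integral>z. 4 * (?c U P z * cnj (?c V P z)) \<partial>lborel)
      = of_real ((norm (U + V))\<^sup>2 * (norm P)\<^sup>2) - of_real ((norm (U - V))\<^sup>2 * (norm P)\<^sup>2)
        + \<i> * of_real ((norm (U + cscale \<i> V))\<^sup>2 * (norm P)\<^sup>2) - \<i> * of_real ((norm (U - cscale \<i> V))\<^sup>2 * (norm P)\<^sup>2)"
      by (simp add: sq(2) moyal_norm(2) del: of_real_power of_real_mult)
    also have "\<dots> = 4 * cinner U V * of_real ((norm P)\<^sup>2)"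
      unfolding polarization_L2 by (simp add: algebra_simps)
    finally show ?thesis by simp
  qed
  \<comment> \<open>\<open>Q\<close> precedes \<open>P\<close> because the second slot of
    \<open>cinner\<close> is conjugate linear.\<close>
  have "4 * (?c U P z * cnj (?c V Q z))
      = ?c U (Q + P) z * cnj (?c V (Q + P) z) - ?c U (Q - P) z * cnj (?c V (Q - P) z)
        + \<i> * (?c U (Q + cscale \<i> P) z * cnj (?c V (Q + cscale \<i> P) z))
        - \<i> * (?c U (Q - cscale \<i> P) z * cnj (?c V (Q - cscale \<i> P) z))" for z
    unfolding cinner.add_right cinner.diff_right cinner_cscale_right
    by (simp add: algebra_simps)
  then have "(\<integral>z. 4 * (?c U P z * cnj (?c V Q z)) \<partial>lborel)
      = cinner U V * of_real ((norm (Q + P))\<^sup>2) - cinner U V * of_real ((norm (Q - P))\<^sup>2)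
        + \<i> * (cinner U V * of_real ((norm (Q + cscale \<i> P))\<^sup>2))
        - \<i> * (cinner U V * of_real ((norm (Q - cscale \<i> P))\<^sup>2))"
    by (simp add: int diag del: of_real_power)
  also have "\<dots> = cinner U V * (4 * cinner Q P)"
    unfolding polarization_L2 by (simp add: algebra_simps)
  finally show "(\<integral>z. ?c U P z * cnj (?c V Q z) \<partial>lborel) = cinner U V * cinner Q P"
    by simp
qed

section \<open>The Arveson spectrum\<close>

text \<open>The bound on the modulus of the sum is included so that the result can be iterated: an
  inner series then serves as one term of an outer one.\<close>

lemma integral_series:
  fixes f :: "nat \<Rightarrow> 'a \<Rightarrow> complex"
  assumes f: "\<And>k. integrable M (f k)" and s: "\<And>x. summable (\<lambda>k. cmod (f k x))"
    and b: "\<And>k. (\<integral>x. cmod (f k x) \<partial>M) \<le> b k" "summable b"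
  shows "integrable M (\<lambda>x. \<Sum>k. f k x)"
    and "(\<integral>x. (\<Sum>k. f k x) \<partial>M) = (\<Sum>k. \<integral>x. f k x \<partial>M)"
    and "(\<integral>x. cmod (\<Sum>k. f k x) \<partial>M) \<le> suminf b"
proof -
  have sI: "summable (\<lambda>k. \<integral>x. cmod (f k x) \<partial>M)"
    by (rule summable_comparison_test'[OF b(2)]) (use b(1) in auto)
  have ae: "AE x in M. summable (\<lambda>k. norm (f k x))" using s by simp
  show int: "integrable M (\<lambda>x. \<Sum>k. f k x)"
    by (rule integrable_suminf[OF f ae sI])
  show "(\<integral>x. (\<Sum>k. f k x) \<partial>M) = (\<Sum>k. \<integral>x. f k x \<partial>M)"
    by (rule integral_suminf[OF f ae sI])
  have n: "\<And>k. integrable M (\<lambda>x. cmod (f k x))" "AE x in M. summable (\<lambda>k. norm (cmod (f k x)))"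
    "summable (\<lambda>k. \<integral>x. norm (cmod (f k x)) \<partial>M)"
    using f s sI by simp_all
  have "(\<integral>x. cmod (\<Sum>k. f k x) \<partial>M) \<le> (\<integral>x. (\<Sum>k. cmod (f k x)) \<partial>M)"
    by (intro integral_mono integrable_norm int integrable_suminf[OF n] summable_norm s)
  also have "\<dots> = (\<Sum>k. \<integral>x. cmod (f k x) \<partial>M)"
    by (rule integral_suminf[OF n])
  also have "\<dots> \<le> suminf b"
    by (rule suminf_le[OF b(1) sI b(2)])
  finally show "(\<integral>x. cmod (\<Sum>k. f k x) \<partial>M) \<le> suminf b" .
qed

section \<open>Traces of shifted operators\<close>

lemma trace_class_basis:
  fixes S :: "'d::finite L2 \<Rightarrow> 'd L2"
  assumes "trace_class S"
  obtains E :: "'d L2 set" where "orthonormal_basis E"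
  using assms unfolding trace_class_def by blast

lemma operator_trace_shift_comp:
  assumes E: "orthonormal_basis (E :: 'd::finite L2 set)"
    and nuc: "\<And>k. norm (u k) = norm (v k :: 'd L2)" "summable (\<lambda>k. (norm (v k))\<^sup>2)"
      "\<And>f. (\<lambda>k. cscale (cinner f (v k)) (u k)) sums S f"
  shows "operator_trace (time_freq_shift z \<circ> S) = (\<Sum>k. cinner (time_freq_shift z (u k)) (v k))"
proof (rule operator_trace_nuclear[OF E])
  show "(\<lambda>k. cscale (cinner f (v k)) (time_freq_shift z (u k))) sums (time_freq_shift z \<circ> S) f" for f
    using bounded_linear.sums[OF bounded_operatorD(1)[OF bounded_operator_time_freq_shift] nuc(3)[of f], of z]
    by (simp add: time_freq_shift_cscale)
  show "summable (\<lambda>k. norm (time_freq_shift z (u k)) * norm (v k))"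
    using nuc(2) by (simp add: nuc(1) power2_eq_square)
qed

text \<open>Conjugation by a time-frequency shift moves both vectors of every rank one term, and
  \<open>adj T\<close> passes to the other side as \<open>T\<close>.\<close>

lemma operator_trace_adj_shift:
  assumes E: "orthonormal_basis (E :: 'd::finite L2 set)" and T: "bounded_operator T"
    and nuc: "\<And>k. norm (u k) = norm (v k :: 'd L2)" "summable (\<lambda>k. (norm (v k))\<^sup>2)"
      "\<And>f. (\<lambda>k. cscale (cinner f (v k)) (u k)) sums S f"
  shows "operator_trace (adj T \<circ> operator_shift z S)
      = (\<Sum>k. cinner (time_freq_shift z (u k)) (T (time_freq_shift z (v k))))"
    and "summable (\<lambda>k. cmod (cinner (time_freq_shift z (u k)) (T (time_freq_shift z (v k)))))"
proof -
  obtain K where K: "0 \<le> K" "\<And>f. norm (T f) \<le> K * norm f"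
    using bounded_operator_bound[OF T] by blast
  obtain K' where K': "0 \<le> K'" "\<And>f. norm (adj T f) \<le> K' * norm f"
    using bounded_operator_bound[OF adj_operator(1)[OF T]] by blast
  have "operator_trace (adj T \<circ> operator_shift z S)
      = (\<Sum>k. cinner (adj T (time_freq_shift z (u k))) (time_freq_shift z (v k)))"
  proof (rule operator_trace_nuclear[OF E])
    fix f
    have "bounded_linear (adj T \<circ> time_freq_shift z)"
      using bounded_operator_comp[OF adj_operator(1)[OF T] bounded_operator_time_freq_shift[of z]]
      by (rule bounded_operatorD(1))
    from bounded_linear.sums[OF this nuc(3)[of "adj (time_freq_shift z) f"]]
    show "(\<lambda>k. cscale (cinner f (time_freq_shift z (v k))) (adj T (time_freq_shift z (u k))))
        sums (adj T \<circ> operator_shift z S) f"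
      by (simp add: operator_shift_def time_freq_shift_cscale bounded_operatorD(2)[OF adj_operator(1)[OF T]]
          adj_operator(2)[OF bounded_operator_time_freq_shift])
  next
    show "summable (\<lambda>k. norm (adj T (time_freq_shift z (u k))) * norm (time_freq_shift z (v k)))"
    proof (rule summable_comparison_test'[OF summable_mult[OF nuc(2)]])
      show "norm (norm (adj T (time_freq_shift z (u k))) * norm (time_freq_shift z (v k)))
          \<le> K' * (norm (v k))\<^sup>2" for k
        using mult_right_mono[OF K'(2)[of "time_freq_shift z (u k)"], of "norm (v k)"]
        by (simp add: nuc(1) power2_eq_square mult_ac)
    qed
  qed
  then show "operator_trace (adj T \<circ> operator_shift z S)
      = (\<Sum>k. cinner (time_freq_shift z (u k)) (T (time_freq_shift z (v k))))"
    by (simp add: adj_operator(2)[OF T])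
  show "summable (\<lambda>k. cmod (cinner (time_freq_shift z (u k)) (T (time_freq_shift z (v k)))))"
  proof (rule summable_comparison_test'[OF summable_mult[OF nuc(2)]])
    fix k
    have "cmod (cinner (time_freq_shift z (u k)) (T (time_freq_shift z (v k))))
        \<le> norm (u k) * norm (T (time_freq_shift z (v k)))"
      using cmod_cinner_le[of "time_freq_shift z (u k)"] by simp
    also have "\<dots> \<le> norm (u k) * (K * norm (v k))"
      using K(2)[of "time_freq_shift z (v k)"] by (intro mult_left_mono) simp_all
    finally show "norm (cmod (cinner (time_freq_shift z (u k)) (T (time_freq_shift z (v k)))))
        \<le> K * (norm (v k))\<^sup>2"
      by (simp add: nuc(1) power2_eq_square mult_ac)
  qed
qed

text \<open>Applying the unitary \<open>time_freq_shift z\<close> to both sides and commuting it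
  past \<open>z'\<close> creates the opposite character. The symplectic Fourier kernel is thereby
  absorbed into vectors independent of \<open>z'\<close>, which is the form \<open>moyal\<close>
  needs.\<close>

lemma cinner_shift_twist:
  "cinner (time_freq_shift z' U) P * exp (- 2 * pi * \<i> * complex_of_real (symplectic_form z z'))
    = cinner (time_freq_shift z' (time_freq_shift z U)) (time_freq_shift z P)"
proof -
  have "cinner (time_freq_shift z' U) P = cinner (time_freq_shift z (time_freq_shift z' U)) (time_freq_shift z P)"
    by (rule cinner_time_freq_shift[symmetric])
  also have "\<dots> = exp (2 * pi * \<i> * complex_of_real (symplectic_form z z'))
      * cinner (time_freq_shift z' (time_freq_shift z U)) (time_freq_shift z P)"
    by (subst time_freq_shift_commute) (rule cinner_cscale_left)
  finally show ?thesis by (simp add: exp_minus field_simps)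
qed

theorem symplectic_fourier_trace:
  fixes S T :: "'d::finite L2 \<Rightarrow> 'd L2"
  assumes S: "trace_class S" and T: "trace_class T"
  shows "symplectic_fourier (\<lambda>z'. operator_trace (adj T \<circ> operator_shift z' S)) z
    = operator_trace (time_freq_shift z \<circ> S) * cnj (operator_trace (time_freq_shift z \<circ> T))"
proof -
  obtain E :: "'d L2 set" where E: "orthonormal_basis E"
    using trace_class_basis[OF S] by blast
  obtain u v where uv: "\<And>k. norm (u k) = norm (v k)" "summable (\<lambda>k. (norm (v k))\<^sup>2)"
    "\<And>f. (\<lambda>k. cscale (cinner f (v k)) (u k)) sums S f"
    using trace_class_nuclear[OF S] by blast
  obtain p q where pq: "\<And>j. norm (p j) = norm (q j)" "summable (\<lambda>j. (norm (q j))\<^sup>2)"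
    "\<And>f. (\<lambda>j. cscale (cinner f (q j)) (p j)) sums T f"
    using trace_class_nuclear[OF T] by blast
  have Tb: "bounded_operator T" using T by (simp add: trace_class_def)
  define e where "e z' = exp (- 2 * pi * \<i> * complex_of_real (symplectic_form z z'))" for z'
  \<comment> \<open>The contribution of the \<open>k\<close>-th term of \<open>S\<close> and the
    \<open>j\<close>-th term of \<open>T\<close>, with the Fourier kernel already absorbed.\<close>
  define w where "w k j z' = cinner (time_freq_shift z' (time_freq_shift z (u k))) (time_freq_shift z (p j))
      * cnj (cinner (time_freq_shift z' (v k)) (q j))" for k j z'
  define F where "F k z' = cinner (time_freq_shift z' (u k)) (T (time_freq_shift z' (v k))) * e z'" for k z'
  define N where "N = (\<Sum>j. (norm (q j))\<^sup>2)"
  have w_le: "cmod (w k j z') \<le> (norm (v k))\<^sup>2 * (norm (q j))\<^sup>2" for k j z'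
  proof -
    have "cmod (w k j z') \<le> (norm (u k) * norm (p j)) * (norm (v k) * norm (q j))"
      unfolding w_def norm_mult complex_mod_cnj
      using cmod_cinner_le[of "time_freq_shift z' (time_freq_shift z (u k))" "time_freq_shift z (p j)"]
        cmod_cinner_le[of "time_freq_shift z' (v k)" "q j"]
      by (intro mult_mono) simp_all
    then show ?thesis by (simp add: uv(1) pq(1) power2_eq_square mult_ac)
  qed
  have w_sum: "summable (\<lambda>j. cmod (w k j z'))" for k z'
    by (rule summable_comparison_test'[OF summable_mult[OF pq(2), of "(norm (v k))\<^sup>2"]]) (simp add: w_le)
  have w_int: "integrable lborel (w k j)" for k j
    unfolding w_def by (rule moyal(1))
  \<comment> \<open>Equal norms within each rank one term make the two summands of the
    \<open>moyal\<close> bound coincide, so their mean is this product.\<close>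
  have w_L1: "(\<integral>z'. cmod (w k j z') \<partial>lborel) \<le> (norm (v k))\<^sup>2 * (norm (q j))\<^sup>2" for k j
    using moyal(2)[of "time_freq_shift z (u k)" "time_freq_shift z (p j)" "v k" "q j"]
    by (simp add: w_def uv(1) pq(1) mult.commute[of "(norm (q _))\<^sup>2"])
  have w_I: "(\<integral>z'. w k j z' \<partial>lborel)
      = cinner (time_freq_shift z (u k)) (v k) * cnj (cinner (time_freq_shift z (p j)) (q j))" for k j
    unfolding w_def moyal(3) by (simp only: cinner_commute[of "q j"])
  \<comment> \<open>The nuclear series of \<open>T\<close> is inserted in the conjugate linear slot,
    which produces the \<open>cnj\<close> in \<open>w\<close>; \<open>cinner_shift_twist\<close>
    takes up \<open>e z'\<close>.\<close>
  have F: "F k z' = (\<Sum>j. w k j z')" for k z'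
  proof -
    have "(\<lambda>j. cinner (time_freq_shift z' (u k)) (cscale (cinner (time_freq_shift z' (v k)) (q j)) (p j)) * e z') sums F k z'"
      unfolding F_def
      by (intro sums_mult2 bounded_linear.sums[OF cinner.bounded_linear_right] pq(3))
    moreover have "cinner (time_freq_shift z' (u k)) (cscale (cinner (time_freq_shift z' (v k)) (q j)) (p j)) * e z'
        = w k j z'" for j
      unfolding w_def e_def cinner_cscale_right cinner_shift_twist[symmetric] by (simp only: mult_ac)
    ultimately show ?thesis by (simp add: sums_iff)
  qed
  note F_series = integral_series[OF w_int w_sum w_L1 summable_mult[OF pq(2)]]
  have "symplectic_fourier (\<lambda>z'. operator_trace (adj T \<circ> operator_shift z' S)) z
      = (\<integral>z'. (\<Sum>k. F k z') \<partial>lborel)"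
  proof -
    have "operator_trace (adj T \<circ> operator_shift z' S) * e z' = (\<Sum>k. F k z')" for z'
      unfolding operator_trace_adj_shift(1)[OF E Tb uv] F_def
      by (rule suminf_mult2[OF summable_norm_cancel[OF operator_trace_adj_shift(2)[OF E Tb uv]]])
    then show ?thesis by (simp only: symplectic_fourier_def e_def)
  qed
  also have "\<dots> = (\<Sum>k. \<integral>z'. F k z' \<partial>lborel)"
  proof (rule integral_series(2))
    show "integrable lborel (F k)" for k
      unfolding F by (rule F_series(1))
    show "summable (\<lambda>k. cmod (F k z'))" for z'
      using operator_trace_adj_shift(2)[OF E Tb uv, of z']
      by (simp add: F_def norm_mult e_def)
    show "(\<integral>z'. cmod (F k z') \<partial>lborel) \<le> N * (norm (v k))\<^sup>2" for k
      unfolding F using F_series(3)[of k] unfolding suminf_mult[OF pq(2)] N_def by (simp only: mult.commute)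
    show "summable (\<lambda>k. N * (norm (v k))\<^sup>2)" by (intro summable_mult uv(2))
  qed
  also have "\<dots> = (\<Sum>k. cinner (time_freq_shift z (u k)) (v k) * cnj (operator_trace (time_freq_shift z \<circ> T)))"
  proof (rule suminf_cong)
    fix k
    have "summable (\<lambda>j. cinner (time_freq_shift z (p j)) (q j))"
      by (rule summable_norm_cancel, rule summable_comparison_test'[OF pq(2)])
        (use cmod_cinner_le[of "time_freq_shift z (p _)" "q _"] in \<open>simp add: pq(1) power2_eq_square\<close>)
    then have s: "(\<lambda>j. cinner (time_freq_shift z (p j)) (q j)) sums operator_trace (time_freq_shift z \<circ> T)"
      unfolding operator_trace_shift_comp[OF E pq] by (rule summable_sums)
    have "(\<integral>z'. F k z' \<partial>lborel) = (\<Sum>j. \<integral>z'. w k j z' \<partial>lborel)"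
      unfolding F by (rule F_series(2))
    also have "\<dots> = cinner (time_freq_shift z (u k)) (v k) * cnj (operator_trace (time_freq_shift z \<circ> T))"
      unfolding w_I by (rule sums_unique[symmetric]) (intro sums_mult, simp add: sums_cnj s)
    finally show "(\<integral>z'. F k z' \<partial>lborel)
        = cinner (time_freq_shift z (u k)) (v k) * cnj (operator_trace (time_freq_shift z \<circ> T))" .
  qed
  also have "\<dots> = operator_trace (time_freq_shift z \<circ> S) * cnj (operator_trace (time_freq_shift z \<circ> T))"
  proof -
    have "summable (\<lambda>k. cinner (time_freq_shift z (u k)) (v k))"
      by (rule summable_norm_cancel, rule summable_comparison_test'[OF uv(2)])
        (use cmod_cinner_le[of "time_freq_shift z (u _)" "v _"] in \<open>simp add: uv(1) power2_eq_square\<close>)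
    then show ?thesis
      unfolding operator_trace_shift_comp[OF E uv] by (rule suminf_mult2[symmetric])
  qed
  finally show ?thesis .
qed

section \<open>Rank one test operators\<close>

lemma adj_rank_one: "adj (\<lambda>f. cscale (cinner f q) p) = (\<lambda>f. cscale (cinner f p) q)"
proof (rule adj_eqI[OF bounded_operator_rank_one])
  fix f g
  have "cnj (cinner g p) = cinner p g" by (rule cinner_commute[symmetric])
  then show "cinner (cscale (cinner f q) p) g = cinner f (cscale (cinner g p) q)"
    by (simp only: cinner_cscale_left cinner_cscale_right mult.commute)
qed

text \<open>In general the absolute value carries the factor \<open>norm p / norm q\<close>. Equal
  norms turn it into \<open>?P\<close>, whose square is \<open>(norm q)\<^sup>2\<close> times itself
  and agrees with the adjoint composed with the operator.\<close>

lemma trace_class_rank_one: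
  fixes p q :: "'d::finite L2"
  assumes E: "orthonormal_basis (E :: 'd L2 set)" and eq: "norm p = norm q"
  shows "trace_class (\<lambda>f. cscale (cinner f q) p)"
  unfolding trace_class_def
proof (intro conjI exI)
  let ?P = "\<lambda>f. cscale (cinner f q) q"
  show "bounded_operator (\<lambda>f. cscale (cinner f q) p)" by (rule bounded_operator_rank_one)
  have form: "cinner (?P f) f = of_real ((cmod (cinner f q))\<^sup>2)" for f
    unfolding cinner_cscale_left complex_norm_square cinner_commute[of q f] ..
  then show "positive_operator ?P"
    unfolding positive_operator_def form
    by (simp add: bounded_operator_rank_one del: of_real_power)
  show "?P \<circ> ?P = adj (\<lambda>f. cscale (cinner f q) p) \<circ> (\<lambda>f. cscale (cinner f q) p)"
    by (simp add: adj_rank_one fun_eq_iff cinner_cscale_left cinner_self eq)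
  show "orthonormal_basis E" by (rule E)
  have "cinner (?P e) e = cinner q e * cinner e q" for e
    by (simp add: cinner_cscale_left)
  then show "(\<lambda>e. cinner (?P e) e) summable_on E"
    using has_sum_imp_summable[OF has_sum_parseval[OF E, of q q]] by simp
qed

lemma operator_trace_rank_one:
  assumes E: "orthonormal_basis (E :: 'd::finite L2 set)"
  shows "operator_trace (\<lambda>f. cscale (cinner f b) (a :: 'd L2)) = cinner a b"
proof -
  let ?a = "\<lambda>k::nat. if k = 0 then a else 0"
  have "operator_trace (\<lambda>f. cscale (cinner f b) a) = (\<Sum>k. cinner (?a k) b)"
  proof (rule operator_trace_nuclear[OF E])
    show "(\<lambda>k. cscale (cinner f b) (?a k)) sums cscale (cinner f b) a" for f
      using sums_single[of 0 "\<lambda>_. cscale (cinner f b) a"]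
      by (simp add: if_distrib[of "cscale _"] cscale.zero_right cong: if_cong)
    show "summable (\<lambda>k. norm (?a k) * norm b)"
      by (rule summable_finite[of "{0}"]) auto
  qed
  also have "\<dots> = cinner a b"
    by (subst suminf_finite[of "{0}"]) (auto simp: cinner.zero_left)
  finally show ?thesis .
qed

text \<open>The phase factor never vanishes, and the two sign changes of \<open>z\<close>
  cancel.\<close>

lemma fourier_wigner_eq_0_iff:
  "fourier_wigner S (- z) = 0 \<longleftrightarrow> operator_trace (time_freq_shift z \<circ> S) = 0"
  by (cases z) (simp add: fourier_wigner_def)

theorem proposition7p5:
  fixes S :: "'d::finite L2 \<Rightarrow> 'd L2"
  assumes "trace_class S"
  shows "arveson_spectrum operator_predual operator_shift S
    = closure (- {z. fourier_wigner S (- z) = 0})"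
proof -
  have "(\<forall>T. trace_class T \<longrightarrow>
      symplectic_fourier (\<lambda>z'. operator_trace (adj T \<circ> operator_shift z' S)) z = 0)
    \<longleftrightarrow> operator_trace (time_freq_shift z \<circ> S) = 0" for z
  proof
    assume all: "\<forall>T. trace_class T \<longrightarrow>
      symplectic_fourier (\<lambda>z'. operator_trace (adj T \<circ> operator_shift z' S)) z = 0"
    obtain E :: "'d L2 set" where E: "orthonormal_basis E"
      using trace_class_basis[OF assms] by blast
    show "operator_trace (time_freq_shift z \<circ> S) = 0"
    \<comment> \<open>The test operator needs a nonzero vector, and a nonzero \<open>S\<close>
      supplies one; for \<open>S = 0\<close> the trace vanishes directly.\<close>
    proof (cases "\<exists>f. S f \<noteq> 0")
      case True
      then obtain p :: "'d L2" where "p \<noteq> 0" by blast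
      let ?T = "\<lambda>f. cscale (cinner f (time_freq_shift z p)) p"
      have T: "trace_class ?T" by (rule trace_class_rank_one[OF E]) simp
      have "time_freq_shift z \<circ> ?T = (\<lambda>f. cscale (cinner f (time_freq_shift z p)) (time_freq_shift z p))"
        by (simp add: fun_eq_iff time_freq_shift_cscale)
      then have "operator_trace (time_freq_shift z \<circ> ?T) = of_real ((norm p)\<^sup>2)"
        by (simp add: operator_trace_rank_one[OF E] cinner_self del: of_real_power)
      moreover have "operator_trace (time_freq_shift z \<circ> S) * cnj (operator_trace (time_freq_shift z \<circ> ?T)) = 0"
        using all T by (simp only: symplectic_fourier_trace[OF assms T, symmetric])
      ultimately show ?thesis using \<open>p \<noteq> 0\<close> by simp
    next
      case False
      then have "time_freq_shift z \<circ> S = (\<lambda>_. 0)"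
        by (simp add: fun_eq_iff bounded_operatorD(4)[OF bounded_operator_time_freq_shift])
      then show ?thesis by (simp add: operator_trace_def cinner.zero_left)
    qed
  qed (simp add: symplectic_fourier_trace[OF assms])
  then show ?thesis
    by (simp add: arveson_spectrum_def spectrum_of_family_def operator_predual_def fourier_wigner_eq_0_iff)
qed

end
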